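(* Let $u_h^{-1}=u_h^0=\Pi u_0\in V_h$ and $U_h^{-1}=U_h^0=\Pi\sqrt{F(u_0)+B}\in V_h$. For time step $\Delta t>0$ and $n\ge 0$ put $u_h^{n,*}=2u_h^n-u_h^{n-1}$, and consider the second order fully discrete coupled BDF2-IEQ-FEM1 scheme for the Allen-Cahn equation: find $u_h^{n+1}\in V_h$ and $U_h^{n+1}\in V_h$ such that for all $\phi,\psi\in V_h$ $$\left(\frac{3u_h^{n+1}-4u_h^n+u_h^{n-1}}{2\Delta t},\phi\right)=-A(\epsilon^2;u_h^{n+1},\phi)-\left(H(u_h^{n,*})U_h^{n+1},\phi\right),$$ $$\left(\frac{3U_h^{n+1}-4U_h^n+U_h^{n-1}}{2\Delta t},\psi\right)=\left(\frac12H(u_h^{n,*})\frac{3u_h^{n+1}-4u_h^n+u_h^{n-1}}{2\Delta t},\psi\right).$$ This scheme admits a unique solution $u_h^{n+1}\in V_h$ and $U_h^{n+1}\in V_h$ satisfying the energy dissipation law $$\bar E_h^{n+1}=\bar E_h^n-\frac1{2\Delta t}\|3u_h^{n+1}-4u_h^n+u_h^{n-1}\|^2-\frac14A(\epsilon^2;u_h^{n+1}-u_h^{n,*},u_h^{n+1}-u_h^{n,*})-\frac12\|U_h^{n+1}-U_h^{n,*}\|^2,$$ for any $\Delta t>0$, where $\bar E_h^n=\frac12\left(E(u_h^n,U_h^n)+E(u_h^{n,*},U_h^{n,*})\right)$ with $U_h^{n,*}=2U_h^n-U_h^{n-1}$.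
   Context: The Allen-Cahn equation is $u_t=\epsilon^2\Delta u-F'(u)$ in $\Omega\times(0,T]$, with $\nabla u\cdot n=0$ on $\partial\Omega$ ($n$ the unit outward normal) and initial data $u_0$. Here $\Omega\subseteq\mathbb{R}^d$ ($d=2,3$) is a bounded domain, $\epsilon>0$ is a parameter, and $F$ is the nonlinear bulk potential (well-known examples: the double well potential $F(u)=\frac14(u^2-1)^2$ and the logarithmic Flory–Huggins potential $F(u)=\frac{\theta}{2}(u\ln u+(1-u)\ln(1-u))+\frac{\theta_c}{2}u(1-u)$ with $\theta,\theta_c>0$). $B\ge0$ is a constant such that $F+B>0$ at the functions where it is evaluated, and $H(w)=F'(w)/\sqrt{F(w)+B}$. $\mathcal T$ is a quasi-uniform triangulation of $\Omega=\cup_{i=1}^N T_i$, and $V_h=\{v\in C^0(\Omega)\cap H^1(\Omega): v|_{T_i}\in P_k\ \forall T_i\in\mathcal T\}$, with $P_k$ the space of polynomials of degree no more than $k$. $(\cdot,\cdot)$ and $\|\cdot\|$ are the $L^2(\Omega)$ inner product and norm, and $\Pi$ is the $L^2$ projection onto $V_h$. For a coefficient $a(x)$, $A(a;q,v)=\int_\Omega a(x)\nabla q\cdot\nabla v\,dx$. The energy is $E(v,V)=\frac12A(\epsilon^2;v,v)+\int_\Omega V^2\,dx-B|\Omega|$.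
   Formalization: The coefficient of ‖3u_h^{n+1}-4u_h^n+u_h^{n-1}‖² in the energy dissipation law is 1/(4Δt) instead of the printed 1/(2Δt); with the stated energy the printed law fails whenever 3u_h^{n+1}-4u_h^n+u_h^{n-1} is nonzero. *)

theory Defs
  imports "HOL-Analysis.Analysis"
begin

section \<open>Square-integrable functions and \<open>H\<^sup>1\<close>\<close>

definition L2_space :: "'a::euclidean_space set \<Rightarrow> ('a \<Rightarrow> real) set" where
  "L2_space \<Omega> = {f. f \<in> borel_measurable (lebesgue_on \<Omega>) \<and>
                    integrable (lebesgue_on \<Omega>) (\<lambda>x. (f x)\<^sup>2)}"

definition L2_inner :: "'a::euclidean_space set \<Rightarrow> ('a \<Rightarrow> real) \<Rightarrow> ('a \<Rightarrow> real) \<Rightarrow> real" where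
  "L2_inner \<Omega> f g = (\<integral>x. f x * g x \<partial>lebesgue_on \<Omega>)"

definition L2_norm :: "'a::euclidean_space set \<Rightarrow> ('a \<Rightarrow> real) \<Rightarrow> real" where
  "L2_norm \<Omega> f = sqrt (L2_inner \<Omega> f f)"

primrec C_times :: "nat \<Rightarrow> ('a::euclidean_space \<Rightarrow> real) \<Rightarrow> bool" where
  "C_times 0 f \<longleftrightarrow> continuous_on UNIV f"
| "C_times (Suc k) f \<longleftrightarrow> f differentiable_on UNIV \<and>
     (\<forall>b\<in>Basis. C_times k (\<lambda>x. frechet_derivative f (at x) b))"

text \<open>\<open>C\<^sub>c\<^sup>\<infinity>(\<Omega>)\<close>, each function being extended by zero to the whole space.\<close>

definition test_functions :: "'a::euclidean_space set \<Rightarrow> ('a \<Rightarrow> real) set" where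
  "test_functions \<Omega> = {\<phi>. (\<forall>k. C_times k \<phi>) \<and> compact (closure {x. \<phi> x \<noteq> 0}) \<and>
                          closure {x. \<phi> x \<noteq> 0} \<subseteq> \<Omega>}"

definition has_weak_gradient ::
    "'a::euclidean_space set \<Rightarrow> ('a \<Rightarrow> real) \<Rightarrow> ('a \<Rightarrow> 'a) \<Rightarrow> bool" where
  "has_weak_gradient \<Omega> v g \<longleftrightarrow>
     (\<forall>b\<in>Basis. (\<lambda>x. g x \<bullet> b) \<in> L2_space \<Omega> \<and>
        (\<forall>\<phi>\<in>test_functions \<Omega>.
           L2_inner \<Omega> v (\<lambda>x. frechet_derivative \<phi> (at x) b) = - L2_inner \<Omega> (\<lambda>x. g x \<bullet> b) \<phi>))"

definition H1_space :: "'a::euclidean_space set \<Rightarrow> ('a \<Rightarrow> real) set" where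
  "H1_space \<Omega> = {v \<in> L2_space \<Omega>. \<exists>g. has_weak_gradient \<Omega> v g}"

text \<open>For \<open>v \<in> H\<^sup>1(\<Omega>)\<close> the weak gradient is determined almost everywhere in \<open>\<Omega>\<close>, so the
  representative chosen here does not affect the integrals in which it is used.\<close>

definition weak_gradient :: "'a::euclidean_space set \<Rightarrow> ('a \<Rightarrow> real) \<Rightarrow> 'a \<Rightarrow> 'a" where
  "weak_gradient \<Omega> v = (SOME g. has_weak_gradient \<Omega> v g)"

definition diffusion_form ::
    "'a::euclidean_space set \<Rightarrow> ('a \<Rightarrow> real) \<Rightarrow> ('a \<Rightarrow> real) \<Rightarrow> ('a \<Rightarrow> real) \<Rightarrow> real" where
  "diffusion_form \<Omega> a q v =
     (\<integral>x. a x * (weak_gradient \<Omega> q x \<bullet> weak_gradient \<Omega> v x) \<partial>lebesgue_on \<Omega>)"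


section \<open>The finite element space\<close>

text \<open>A domain is an open set here and the elements are closed simplices, so the union of the
  elements is the closure of the domain.\<close>

definition triangulates :: "'a::euclidean_space set set \<Rightarrow> 'a set \<Rightarrow> bool" where
  "triangulates \<T> \<Omega> \<longleftrightarrow> triangulation \<T> \<and> (\<forall>T\<in>\<T>. int DIM('a) simplex T \<and> interior T \<subseteq> \<Omega>) \<and>
     \<Union>\<T> = closure \<Omega>"

text \<open>The mesh size is at most \<open>\<sigma>\<close> times the inradius of every element.\<close>

definition quasi_uniform :: "real \<Rightarrow> 'a::euclidean_space set set \<Rightarrow> bool" where
  "quasi_uniform \<sigma> \<T> \<longleftrightarrow>
     (\<forall>T\<in>\<T>. \<forall>T'\<in>\<T>. \<exists>x r. cball x r \<subseteq> T \<and> diameter T' \<le> \<sigma> * r)"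

definition multi_indices :: "nat \<Rightarrow> ('a::euclidean_space \<Rightarrow> nat) set" where
  "multi_indices k = {\<alpha>. (\<forall>b. b \<notin> Basis \<longrightarrow> \<alpha> b = 0) \<and> (\<Sum>b\<in>Basis. \<alpha> b) \<le> k}"

definition polys :: "nat \<Rightarrow> ('a::euclidean_space \<Rightarrow> real) set" where
  "polys k = {p. \<exists>c. p = (\<lambda>x. \<Sum>\<alpha>\<in>multi_indices k. c \<alpha> * (\<Prod>b\<in>Basis. (x \<bullet> b) ^ \<alpha> b))}"

text \<open>The last condition makes a function on the closed domain and its representation as a total
  function correspond one to one, so that uniqueness can be expressed by equality.\<close>

definition fem_space :: "'a::euclidean_space set \<Rightarrow> 'a set set \<Rightarrow> nat \<Rightarrow> ('a \<Rightarrow> real) set" where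
  "fem_space \<Omega> \<T> k = {v. continuous_on (closure \<Omega>) v \<and> v \<in> H1_space \<Omega> \<and>
     (\<forall>T\<in>\<T>. \<exists>p\<in>polys k. \<forall>x\<in>T. v x = p x) \<and> (\<forall>x. x \<notin> closure \<Omega> \<longrightarrow> v x = 0)}"

definition L2_proj ::
    "'a::euclidean_space set \<Rightarrow> ('a \<Rightarrow> real) set \<Rightarrow> ('a \<Rightarrow> real) \<Rightarrow> 'a \<Rightarrow> real" where
  "L2_proj \<Omega> V w = (THE v. v \<in> V \<and> (\<forall>\<phi>\<in>V. L2_inner \<Omega> v \<phi> = L2_inner \<Omega> w \<phi>))"


section \<open>The BDF2-IEQ scheme\<close>

definition ieq_H :: "(real \<Rightarrow> real) \<Rightarrow> real \<Rightarrow> real \<Rightarrow> real" where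
  "ieq_H F B w = deriv F w / sqrt (F w + B)"

definition extrap :: "('a \<Rightarrow> real) \<Rightarrow> ('a \<Rightarrow> real) \<Rightarrow> 'a \<Rightarrow> real" where
  "extrap w\<^sub>1 w\<^sub>0 = (\<lambda>x. 2 * w\<^sub>1 x - w\<^sub>0 x)"

definition bdf2 :: "('a \<Rightarrow> real) \<Rightarrow> ('a \<Rightarrow> real) \<Rightarrow> ('a \<Rightarrow> real) \<Rightarrow> 'a \<Rightarrow> real" where
  "bdf2 w\<^sub>2 w\<^sub>1 w\<^sub>0 = (\<lambda>x. 3 * w\<^sub>2 x - 4 * w\<^sub>1 x + w\<^sub>0 x)"

text \<open>\<open>u\<^sub>2, U\<^sub>2\<close> are the unknowns at the new time level; \<open>u\<^sub>1, U\<^sub>1\<close> and \<open>u\<^sub>0, U\<^sub>0\<close> belong to the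
  current and the previous level.\<close>

definition bdf2_ieq_step ::
    "'a::euclidean_space set \<Rightarrow> ('a \<Rightarrow> real) set \<Rightarrow> (real \<Rightarrow> real) \<Rightarrow> real \<Rightarrow> real \<Rightarrow> real \<Rightarrow>
     ('a \<Rightarrow> real) \<Rightarrow> ('a \<Rightarrow> real) \<Rightarrow> ('a \<Rightarrow> real) \<Rightarrow> ('a \<Rightarrow> real) \<Rightarrow> ('a \<Rightarrow> real) \<Rightarrow> ('a \<Rightarrow> real) \<Rightarrow> bool" where
  "bdf2_ieq_step \<Omega> V F B \<epsilon> \<Delta>t u\<^sub>0 U\<^sub>0 u\<^sub>1 U\<^sub>1 u\<^sub>2 U\<^sub>2 \<longleftrightarrow>
     u\<^sub>2 \<in> V \<and> U\<^sub>2 \<in> V \<and>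
     (\<forall>\<phi>\<in>V. L2_inner \<Omega> (\<lambda>x. bdf2 u\<^sub>2 u\<^sub>1 u\<^sub>0 x / (2 * \<Delta>t)) \<phi> =
        - diffusion_form \<Omega> (\<lambda>_. \<epsilon>\<^sup>2) u\<^sub>2 \<phi>
        - L2_inner \<Omega> (\<lambda>x. ieq_H F B (extrap u\<^sub>1 u\<^sub>0 x) * U\<^sub>2 x) \<phi>) \<and>
     (\<forall>\<psi>\<in>V. L2_inner \<Omega> (\<lambda>x. bdf2 U\<^sub>2 U\<^sub>1 U\<^sub>0 x / (2 * \<Delta>t)) \<psi> =
        L2_inner \<Omega>
          (\<lambda>x. 1 / 2 * ieq_H F B (extrap u\<^sub>1 u\<^sub>0 x) * (bdf2 u\<^sub>2 u\<^sub>1 u\<^sub>0 x / (2 * \<Delta>t))) \<psi>)"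

definition ieq_energy ::
    "'a::euclidean_space set \<Rightarrow> real \<Rightarrow> real \<Rightarrow> ('a \<Rightarrow> real) \<Rightarrow> ('a \<Rightarrow> real) \<Rightarrow> real" where
  "ieq_energy \<Omega> \<epsilon> B v W = 1 / 2 * diffusion_form \<Omega> (\<lambda>_. \<epsilon>\<^sup>2) v v
     + (\<integral>x. (W x)\<^sup>2 \<partial>lebesgue_on \<Omega>) - B * measure lebesgue \<Omega>"

text \<open>The term \<open>\<parallel>bdf2 u\<parallel>\<^sup>2\<close> enters the dissipation law for this energy with the factor
  \<open>1 / (4 * \<Delta>t)\<close>, not \<open>1 / (2 * \<Delta>t)\<close> as it is printed in the source: taking \<open>\<phi> = bdf2 u\<close> and
  \<open>\<psi> = 4 * \<Delta>t * U\<^sub>2\<close> in the scheme gives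
  \<open>\<parallel>bdf2 u\<parallel>\<^sup>2 / (2 * \<Delta>t) = - A(\<epsilon>\<^sup>2; u\<^sub>2, bdf2 u) - 2 * (bdf2 U, U\<^sub>2)\<close>, while the energy difference
  is \<open>- 1 / 2\<close> times this right-hand side minus the two extrapolation terms.\<close>

definition bdf2_energy ::
    "'a::euclidean_space set \<Rightarrow> real \<Rightarrow> real \<Rightarrow>
     ('a \<Rightarrow> real) \<Rightarrow> ('a \<Rightarrow> real) \<Rightarrow> ('a \<Rightarrow> real) \<Rightarrow> ('a \<Rightarrow> real) \<Rightarrow> real" where
  "bdf2_energy \<Omega> \<epsilon> B u\<^sub>0 U\<^sub>0 u\<^sub>1 U\<^sub>1 =
     1 / 2 * (ieq_energy \<Omega> \<epsilon> B u\<^sub>1 U\<^sub>1 + ieq_energy \<Omega> \<epsilon> B (extrap u\<^sub>1 u\<^sub>0) (extrap U\<^sub>1 U\<^sub>0))"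

end

theory Submission
  imports Defs "HOL-Library.Function_Algebras"
begin

text \<open>
  One step of the scheme is a square linear system, so it has a unique solution as soon as its
  bilinear form vanishes on no nonzero diagonal pair. Write \<open>m\<close> for the \<open>L\<^sup>2\<close> inner product, \<open>d\<close> for the
  diffusion form and \<open>h(U, \<phi>) = (H U, \<phi>)\<close>. Multiplying the second equation by \<open>4 \<Delta>t / 3\<close> and adding it
  to the first gives on \<open>V \<times> V\<close> the form
  \<open>3 m(u, \<phi>) / (2 \<Delta>t) + d(u, \<phi>) + h(U, \<phi>) + 2 m(U, \<psi>) - h(u, \<psi>)\<close>,
  whose diagonal is \<open>3 m(u, u) / (2 \<Delta>t) + d(u, u) + 2 m(U, U)\<close>: the coupling cancels by the symmetry of
  \<open>h\<close>, for every \<open>\<Delta>t > 0\<close> (\<open>ex1_step\<close>).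

  The energy law comes from testing with \<open>\<phi> = 3 u\<^sub>2 - 4 u\<^sub>1 + u\<^sub>0\<close> and \<open>\<psi> = U\<^sub>2\<close>, which eliminates \<open>h\<close>, and from
  the polarisation identity \<open>bdf_identity\<close>, applied to \<open>d\<close> and to \<open>m\<close> (\<open>step_energy\<close>). Both arguments use
  only that \<open>m\<close>, \<open>d\<close>, \<open>h\<close> are symmetric bilinear forms on a finite-dimensional space, \<open>m\<close> positive definite
  and \<open>d\<close> positive semidefinite, and are carried out for abstract forms.

  The analytic part is that the concrete forms qualify (\<open>ieq_forms_fem\<close>). Positivity of \<open>m\<close> holds since a
  continuous function on the closed domain that vanishes almost everywhere on the open domain is
  zero. The form \<open>d\<close> is built from an arbitrary choice of weak gradient for each function, so its
  bilinearity requires weak gradients to be unique almost everywhere. This is the fundamental lemma of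
  the calculus of variations (\<open>AE_zero_if_orthogonal_to_test_functions\<close>): smooth bumps converge boundedly
  to the indicator of any box, so an integrable function orthogonal to all test functions has integral zero
  over every box. Finally, the previous time levels lie in \<open>V\<close>: the first two
  are \<open>L\<^sup>2\<close> projections, which exist in finite dimension by \<open>ex1_representer\<close>, the later ones are solutions
  of earlier steps.
\<close>

section \<open>Functions as a real vector space\<close>

text \<open>Pointwise scaling makes \<open>subspace\<close>, \<open>span\<close> and dimension arguments available for spaces of functions
  and for their products.\<close>

instantiation "fun" :: (type, real_vector) real_vector
begin

definition "c *\<^sub>R f = (\<lambda>x. c *\<^sub>R f x)"

instance
  by standard (auto simp: scaleR_fun_def fun_eq_iff algebra_simps)

end

lemma fun_apply [simp]:
  fixes f g :: "'i \<Rightarrow> 'b::real_vector"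
  shows "(c *\<^sub>R f) x = c *\<^sub>R f x" "(f - g) x = f x - g x"
  by (simp_all add: scaleR_fun_def)

lemma sum_fun_apply:
  fixes f :: "'i \<Rightarrow> 'j \<Rightarrow> 'b::real_vector"
  shows "(\<Sum>i\<in>I. f i) x = (\<Sum>i\<in>I. f i x)"
  by (induction I rule: infinite_finite_induct) auto

section \<open>Anisotropic bilinear forms on finite-dimensional subspaces\<close>

text \<open>The integrals behind the \<open>L\<^sup>2\<close> and diffusion forms are bilinear only where the integrands are
  integrable, hence bilinearity relative to a subspace \<open>W\<close>.\<close>

locale bilinear_form_on =
  fixes W :: "'b::real_vector set" and a :: "'b \<Rightarrow> 'b \<Rightarrow> real"
  assumes subspace: "subspace W"
    and add_left: "\<lbrakk>x \<in> W; y \<in> W; z \<in> W\<rbrakk> \<Longrightarrow> a (x + y) z = a x z + a y z"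
    and add_right: "\<lbrakk>x \<in> W; y \<in> W; z \<in> W\<rbrakk> \<Longrightarrow> a x (y + z) = a x y + a x z"
    and scale_left: "\<lbrakk>x \<in> W; y \<in> W\<rbrakk> \<Longrightarrow> a (c *\<^sub>R x) y = c * a x y"
    and scale_right: "\<lbrakk>x \<in> W; y \<in> W\<rbrakk> \<Longrightarrow> a x (c *\<^sub>R y) = c * a x y"
begin

lemma closed [simp, intro]:
  "0 \<in> W" "x \<in> W \<Longrightarrow> y \<in> W \<Longrightarrow> x + y \<in> W" "x \<in> W \<Longrightarrow> c *\<^sub>R x \<in> W"
  "x \<in> W \<Longrightarrow> y \<in> W \<Longrightarrow> x - y \<in> W"
  using subspace subspace_0 subspace_add subspace_scale subspace_diff by blast+

lemma diff_left: "\<lbrakk>x \<in> W; y \<in> W; z \<in> W\<rbrakk> \<Longrightarrow> a (x - y) z = a x z - a y z"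
  using add_left[of "x - y" y z] by simp

lemma diff_right: "\<lbrakk>x \<in> W; y \<in> W; z \<in> W\<rbrakk> \<Longrightarrow> a x (y - z) = a x y - a x z"
  using add_right[of x "y - z" z] by simp

lemma zero_left: "x \<in> W \<Longrightarrow> a 0 x = 0"
  using scale_left[of 0 x 0] by simp

lemma zero_right: "x \<in> W \<Longrightarrow> a x 0 = 0"
  using scale_right[of x 0 0] by simp

lemmas expand = add_left add_right scale_left scale_right diff_left diff_right
  zero_left zero_right

end

definition linear_form_on :: "'b::real_vector set \<Rightarrow> ('b \<Rightarrow> real) \<Rightarrow> bool" where
  "linear_form_on W l \<longleftrightarrow> (\<forall>x\<in>W. \<forall>y\<in>W. l (x + y) = l x + l y) \<and> (\<forall>c. \<forall>x\<in>W. l (c *\<^sub>R x) = c * l x)"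

text \<open>Gram--Schmidt without symmetry: let \<open>f\<close> be a new generator \<open>e\<close> minus the element of \<open>span S\<close> that
  represents \<open>a e\<close>. Then \<open>a f\<close> vanishes on \<open>span S\<close>, so adding a multiple of \<open>f\<close> adjusts the value at \<open>f\<close>
  without disturbing those on \<open>span S\<close>. The required factor exists because \<open>a f f \<noteq> 0\<close>, unless \<open>f = 0\<close>, when
  \<open>e\<close> enlarges nothing.\<close>

lemma ex_representer_on_span:
  assumes "finite S" "S \<subseteq> W" and a: "bilinear_form_on W a"
    and anisotropic: "\<And>x. x \<in> W \<Longrightarrow> x \<noteq> 0 \<Longrightarrow> a x x \<noteq> 0"
    and l: "linear_form_on W l"
  shows "\<exists>v\<in>span S. \<forall>\<phi>\<in>span S. a v \<phi> = l \<phi>"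
  using assms(1,2) l
proof (induction S arbitrary: l rule: finite_induct)
  case empty
  interpret bilinear_form_on W a by (rule a)
  have "l (0 *\<^sub>R 0) = 0 * l 0"
    using empty.prems(2) closed(1) unfolding linear_form_on_def by blast
  then show ?case by (simp add: zero_right)
next
  case (insert e S)
  interpret bilinear_form_on W a by (rule a)
  have e: "e \<in> W" and S: "S \<subseteq> W" using insert.prems by auto
  have span_W: "span S \<subseteq> W" by (simp add: S span_minimal subspace)
  have "linear_form_on W (a e)"
    using e by (auto simp: linear_form_on_def add_right scale_right)
  then obtain w where w: "w \<in> span S" "\<forall>\<phi>\<in>span S. a w \<phi> = a e \<phi>"
    using insert.IH S by blast
  obtain v where v: "v \<in> span S" "\<forall>\<phi>\<in>span S. a v \<phi> = l \<phi>"
    using insert.IH[OF S insert.prems(2)] by blast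
  have wW: "w \<in> W" and vW: "v \<in> W" using w v span_W by auto
  \<comment> \<open>\<open>f\<close> is the part of \<open>e\<close> that \<open>span S\<close> cannot see.\<close>
  define f where "f = e - w"
  have fW: "f \<in> W" using e wW by (simp add: f_def)
  have f0: "a f \<phi> = 0" if "\<phi> \<in> span S" for \<phi>
    using that w span_W e wW by (auto simp: f_def diff_left)
  have decomp: "\<exists>c. \<exists>s\<in>span S. \<phi> = c *\<^sub>R f + s" if \<phi>: "\<phi> \<in> span (insert e S)" for \<phi>
  proof -
    obtain c where "\<phi> - c *\<^sub>R e \<in> span S"
      using \<phi> span_breakdown_eq[of \<phi> e S] by blast
    then have "\<phi> - c *\<^sub>R e + c *\<^sub>R w \<in> span S" using w span_add span_scale by blast
    then show ?thesis
      by (intro exI[of _ c] bexI[of _ "\<phi> - c *\<^sub>R e + c *\<^sub>R w"]) (auto simp: f_def algebra_simps)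
  qed
  have sub: "span S \<subseteq> span (insert e S)" by (simp add: span_mono subset_insertI)
  have f_span: "f \<in> span (insert e S)"
    unfolding f_def by (meson span_diff span_base insertI1 sub subsetD w(1))
  have l_lin: "l (x + y) = l x + l y" "l (c *\<^sub>R x) = c * l x" if "x \<in> W" "y \<in> W" for x y c
    using insert.prems(2) that by (auto simp: linear_form_on_def)
  show ?case
  proof (cases "f = 0")
    case True
    with decomp have "span (insert e S) \<subseteq> span S" by auto
    then show ?thesis using v sub by blast
  next
    case False
    then have ff: "a f f \<noteq> 0" using anisotropic fW by blast
    define t where "t = (l f - a v f) / a f f"
    have "a (v + t *\<^sub>R f) \<phi> = l \<phi>" if "\<phi> \<in> span (insert e S)" for \<phi>
    proof -
      obtain c s where s: "s \<in> span S" and \<phi>: "\<phi> = c *\<^sub>R f + s" using decomp \<open>\<phi> \<in> _\<close> by blast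
      have sW: "s \<in> W" using s span_W by auto
      have "t * a f f = l f - a v f" using ff by (simp add: t_def)
      then have "c * a v f + t * (c * a f f) = c * l f"
        by (simp add: algebra_simps) (metis distrib_left mult.commute mult.left_commute add.commute diff_add_cancel)
      moreover have "a v s = l s" using v s by blast
      ultimately show ?thesis
        using fW vW sW f0[OF s] by (simp add: \<phi> expand l_lin algebra_simps)
    qed
    moreover have "v + t *\<^sub>R f \<in> span (insert e S)"
      using v f_span sub span_add span_scale by (metis subsetD)
    ultimately show ?thesis by blast
  qed
qed

text \<open>The generators \<open>E\<close> need not lie in \<open>W\<close>: they only bound its dimension. For finite elements they are
  discontinuous piecewise monomials.\<close>

lemma ex1_representer:
  assumes "finite E" "W \<subseteq> span E" and a: "bilinear_form_on W a"
    and anisotropic: "\<And>x. x \<in> W \<Longrightarrow> x \<noteq> 0 \<Longrightarrow> a x x \<noteq> 0"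
    and l: "linear_form_on W l"
  shows "\<exists>!v. v \<in> W \<and> (\<forall>\<phi>\<in>W. a v \<phi> = l \<phi>)"
proof -
  interpret bilinear_form_on W a by (rule a)
  obtain S where S: "S \<subseteq> W" "independent S" "W \<subseteq> span S"
    using maximal_independent_subset[of W] by blast
  then have "finite S" using independent_span_bound assms(1,2) by (metis subset_trans)
  moreover have "span S = W" by (metis S(1,3) span_minimal subset_antisym subspace)
  ultimately obtain v where v: "v \<in> W" "\<forall>\<phi>\<in>W. a v \<phi> = l \<phi>"
    using ex_representer_on_span[OF _ S(1) a anisotropic l] by auto
  moreover have "v' = v" if "v' \<in> W" "\<forall>\<phi>\<in>W. a v' \<phi> = l \<phi>" for v'
  proof -
    have "a (v' - v) (v' - v) = 0" using that v by (auto simp: diff_left)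
    then show ?thesis using anisotropic[of "v' - v"] that v by auto
  qed
  ultimately show ?thesis by blast
qed

lemma bilinear_form_on_subspace:
  assumes "bilinear_form_on W a" "subspace V" "V \<subseteq> W"
  shows "bilinear_form_on V a"
proof -
  interpret bilinear_form_on W a by fact
  show ?thesis
    by standard (use assms(2,3) in \<open>auto intro: add_left add_right scale_left scale_right\<close>)
qed

section \<open>The BDF2-IEQ step for abstract forms\<close>

text \<open>Here \<open>m\<close> stands for the \<open>L\<^sup>2\<close> inner product, \<open>d\<close> for diffusion and \<open>h\<close> for multiplication by the
  extrapolated nonlinearity.\<close>

locale ieq_forms =
  M: bilinear_form_on W m + A: bilinear_form_on W d + H: bilinear_form_on W h
  for W :: "'b::real_vector set" and m d h +
  assumes sym: "x \<in> W \<Longrightarrow> y \<in> W \<Longrightarrow> m x y = m y x"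
      "x \<in> W \<Longrightarrow> y \<in> W \<Longrightarrow> d x y = d y x"
      "x \<in> W \<Longrightarrow> y \<in> W \<Longrightarrow> h x y = h y x"
    and m_pos: "x \<in> W \<Longrightarrow> x \<noteq> 0 \<Longrightarrow> m x x > 0"
    and d_nonneg: "x \<in> W \<Longrightarrow> d x x \<ge> 0"
begin

definition bdf :: "'b \<Rightarrow> 'b \<Rightarrow> 'b \<Rightarrow> 'b" where
  "bdf x y z = 3 *\<^sub>R x - 4 *\<^sub>R y + z"

definition step :: "real \<Rightarrow> 'b \<Rightarrow> 'b \<Rightarrow> 'b \<Rightarrow> 'b \<Rightarrow> 'b \<Rightarrow> 'b \<Rightarrow> bool" where
  "step \<tau> u0 U0 u1 U1 u2 U2 \<longleftrightarrow> u2 \<in> W \<and> U2 \<in> W \<and>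
     (\<forall>\<phi>\<in>W. m (bdf u2 u1 u0) \<phi> / (2 * \<tau>) = - d u2 \<phi> - h U2 \<phi>) \<and>
     (\<forall>\<psi>\<in>W. m (bdf U2 U1 U0) \<psi> / (2 * \<tau>) = h (bdf u2 u1 u0) \<psi> / (4 * \<tau>))"

text \<open>The second equation enters the combined form with the factor \<open>4 * \<tau> / 3\<close>, chosen so that the two
  occurrences of \<open>h\<close> cancel on the diagonal.\<close>

lemma ex1_step:
  assumes "finite E" "W \<subseteq> span E" and \<tau>: "\<tau> > 0"
    and W: "u0 \<in> W" "U0 \<in> W" "u1 \<in> W" "U1 \<in> W"
  shows "\<exists>!w. step \<tau> u0 U0 u1 U1 (fst w) (snd w)"
proof -
  define a where "a = (\<lambda>(u, U) (\<phi>, \<psi>).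
    3 / (2 * \<tau>) * m u \<phi> + d u \<phi> + h U \<phi> + 2 * m U \<psi> - h u \<psi>)"
  \<comment> \<open>The known parts of the two backward differences, up to sign.\<close>
  define g where "g = 4 *\<^sub>R u1 - u0"
  define G where "G = 4 *\<^sub>R U1 - U0"
  define l where "l = (\<lambda>(\<phi>, \<psi>). m g \<phi> / (2 * \<tau>) + 2 / 3 * m G \<psi> - h g \<psi> / 3)"
  have gW: "g \<in> W" "G \<in> W" using W by (auto simp: g_def G_def)
  let ?E = "(\<lambda>x. (x, 0)) ` E \<union> (\<lambda>x. (0, x)) ` E"
  have bilinear: "bilinear_form_on (W \<times> W) a"
  proof
    show "subspace (W \<times> W)" by (rule subspace_Times) (rule M.subspace)+
  qed (auto simp: a_def M.expand A.expand H.expand algebra_simps add_divide_distrib)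
  have linear: "linear_form_on (W \<times> W) l"
    using gW by (auto simp: linear_form_on_def l_def M.expand H.expand algebra_simps add_divide_distrib)
  have anisotropic: "a x x \<noteq> 0" if x: "x \<in> W \<times> W" "x \<noteq> 0" for x
  proof -
    obtain u U where U: "x = (u, U)" "u \<in> W" "U \<in> W" using x by auto
    have nn: "m u u \<ge> 0" "m U U \<ge> 0" "d u u \<ge> 0"
      using m_pos U d_nonneg M.zero_left by (metis less_eq_real_def)+
    have "a x x = 3 / (2 * \<tau>) * m u u + d u u + 2 * m U U"
      using U by (simp add: a_def sym(3))
    moreover have "m u u > 0 \<or> m U U > 0" using x U m_pos by (auto simp: zero_prod_def)
    moreover have "3 / (2 * \<tau>) * m u u > 0" if "m u u > 0" using that \<tau> by simp
    moreover have "3 / (2 * \<tau>) * m u u \<ge> 0" using nn \<tau> by simp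
    ultimately show ?thesis using nn by auto
  qed
  have spanned: "W \<times> W \<subseteq> span ?E"
  proof clarify
    fix x y assume xy: "x \<in> W" "y \<in> W"
    have 1: "linear (\<lambda>x::'b. (x, 0::'b))" "linear (\<lambda>x::'b. (0::'b, x))"
      by (auto intro!: linearI)
    have "(x, 0) \<in> span ((\<lambda>x. (x, 0::'b)) ` E)" "(0, y) \<in> span ((\<lambda>x. (0::'b, x)) ` E)"
      unfolding linear_span_image[OF 1(1)] linear_span_image[OF 1(2)] using xy assms(2) by auto
    then have "(x, 0) \<in> span ?E" "(0, y) \<in> span ?E"
      using span_mono[OF Un_upper1] span_mono[OF Un_upper2] by (metis subsetD)+
    from span_add[OF this] show "(x, y) \<in> span ?E" by simp
  qed
  have "\<exists>!w. w \<in> W \<times> W \<and> (\<forall>z\<in>W \<times> W. a w z = l z)"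
    by (rule ex1_representer[OF _ spanned bilinear anisotropic linear]) (simp_all add: assms(1))
  moreover have "w \<in> W \<times> W \<and> (\<forall>z\<in>W \<times> W. a w z = l z) \<longleftrightarrow> step \<tau> u0 U0 u1 U1 (fst w) (snd w)" for w
  proof (cases w)
    case (Pair u U)
    show ?thesis
    proof (cases "u \<in> W \<and> U \<in> W")
      case True
      then have uW: "u \<in> W" "U \<in> W" by auto
      have D: "bdf u u1 u0 = 3 *\<^sub>R u - g" "bdf U U1 U0 = 3 *\<^sub>R U - G"
        by (simp_all add: bdf_def g_def G_def algebra_simps)
      have split: "(\<forall>z\<in>W \<times> W. a w z = l z) \<longleftrightarrow>
          (\<forall>\<phi>\<in>W. a w (\<phi>, 0) = l (\<phi>, 0)) \<and> (\<forall>\<psi>\<in>W. a w (0, \<psi>) = l (0, \<psi>))" (is "?L \<longleftrightarrow> ?R")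
      proof
        show ?L if ?R
        proof clarify
          fix \<phi> \<psi> assume "\<phi> \<in> W" "\<psi> \<in> W"
          then have "a w (\<phi>, \<psi>) = a w (\<phi>, 0) + a w (0, \<psi>)" "l (\<phi>, \<psi>) = l (\<phi>, 0) + l (0, \<psi>)"
            using uW gW by (auto simp: Pair a_def l_def M.zero_right A.zero_right H.zero_right)
          then show "a w (\<phi>, \<psi>) = l (\<phi>, \<psi>)" using \<open>?R\<close> \<open>\<phi> \<in> W\<close> \<open>\<psi> \<in> W\<close> by simp
        qed
      qed auto
      have 1: "a w (\<phi>, 0) = l (\<phi>, 0) \<longleftrightarrow> m (bdf u u1 u0) \<phi> / (2 * \<tau>) = - d u \<phi> - h U \<phi>"
        if "\<phi> \<in> W" for \<phi>
        using that uW gW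
        by (auto simp: Pair a_def l_def M.zero_right A.zero_right H.zero_right D M.expand diff_divide_distrib)
      have quarter: "X / (2 * \<tau>) = Y / (4 * \<tau>) \<longleftrightarrow> 2 * X = Y" for X Y
        using \<tau> by (auto simp: field_simps)
      have 2: "a w (0, \<psi>) = l (0, \<psi>) \<longleftrightarrow> m (bdf U U1 U0) \<psi> / (2 * \<tau>) = h (bdf u u1 u0) \<psi> / (4 * \<tau>)"
        if "\<psi> \<in> W" for \<psi>
        unfolding quarter using that uW gW
        by (auto simp: Pair a_def l_def M.zero_right A.zero_right H.zero_right D M.expand H.expand)
      show ?thesis unfolding split step_def using 1 2 True by (simp add: Pair)
    qed (auto simp: Pair step_def)
  qed
  ultimately show ?thesis by auto
qed

text \<open>The algebraic source of G-stability of BDF2: testing the difference operator with the newest value gives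
  a difference of squared norms plus a numerical dissipation term.\<close>

lemma bdf_identity:
  fixes q
  assumes q: "bilinear_form_on W q" and sym_q: "\<And>x y. x \<in> W \<Longrightarrow> y \<in> W \<Longrightarrow> q x y = q y x"
    and W: "x \<in> W" "y \<in> W" "z \<in> W"
  shows "2 * q (bdf x y z) x =
    q x x + q (2 *\<^sub>R x - y) (2 *\<^sub>R x - y) - q y y - q (2 *\<^sub>R y - z) (2 *\<^sub>R y - z)
    + q (x - (2 *\<^sub>R y - z)) (x - (2 *\<^sub>R y - z))"
proof -
  interpret q: bilinear_form_on W q by (rule q)
  show ?thesis
    using W by (simp add: bdf_def q.expand sym_q[of y x] sym_q[of z x] sym_q[of z y] algebra_simps)
qed

text \<open>Testing with \<open>bdf u2 u1 u0\<close> and \<open>U2\<close> and eliminating \<open>h\<close> expresses the dissipation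
  \<open>m (bdf u2 u1 u0) (bdf u2 u1 u0)\<close> as \<open>- \<tau>\<close> times the left-hand side of \<open>bdf_identity\<close> for \<open>d\<close> and the
  \<open>u\<close>-levels, minus \<open>2 * \<tau>\<close> times the one for \<open>m\<close> and the \<open>U\<close>-levels. The constant \<open>c\<close> cancels.\<close>

lemma step_energy:
  fixes c :: real
  assumes "step \<tau> u0 U0 u1 U1 u2 U2" and \<tau>: "\<tau> > 0"
    and W: "u0 \<in> W" "U0 \<in> W" "u1 \<in> W" "U1 \<in> W"
  defines "e \<equiv> \<lambda>x X. 1 / 2 * d x x + m X X - c"
  shows "1 / 2 * (e u2 U2 + e (2 *\<^sub>R u2 - u1) (2 *\<^sub>R U2 - U1)) =
    1 / 2 * (e u1 U1 + e (2 *\<^sub>R u1 - u0) (2 *\<^sub>R U1 - U0))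
    - 1 / (4 * \<tau>) * m (bdf u2 u1 u0) (bdf u2 u1 u0)
    - 1 / 4 * d (u2 - (2 *\<^sub>R u1 - u0)) (u2 - (2 *\<^sub>R u1 - u0))
    - 1 / 2 * m (U2 - (2 *\<^sub>R U1 - U0)) (U2 - (2 *\<^sub>R U1 - U0))"
proof -
  have W2: "u2 \<in> W" "U2 \<in> W" using assms(1) by (auto simp: step_def)
  have D: "bdf u2 u1 u0 \<in> W" using W W2 by (auto simp: bdf_def)
  have 1: "m (bdf u2 u1 u0) (bdf u2 u1 u0) / (2 * \<tau>) = - d u2 (bdf u2 u1 u0) - h U2 (bdf u2 u1 u0)"
    using assms(1) D unfolding step_def by blast
  have "m (bdf U2 U1 U0) U2 / (2 * \<tau>) = h (bdf u2 u1 u0) U2 / (4 * \<tau>)"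
    using assms(1) W2 unfolding step_def by blast
  then have 2: "h U2 (bdf u2 u1 u0) = 2 * m (bdf U2 U1 U0) U2"
    using \<tau> sym(3)[OF W2(2) D] by (simp add: field_simps)
  \<comment> \<open>Both terms on the right are now in the form of \<open>bdf_identity\<close>.\<close>
  have 3: "1 / (4 * \<tau>) * m (bdf u2 u1 u0) (bdf u2 u1 u0)
      = - (1 / 4) * (2 * d (bdf u2 u1 u0) u2) - 1 / 2 * (2 * m (bdf U2 U1 U0) U2)"
    using 1 2 sym(2)[OF W2(1) D] by simp
  show ?thesis
    unfolding e_def 3
      bdf_identity[OF A.bilinear_form_on_axioms sym(2) W2(1) W(3,1), simplified]
      bdf_identity[OF M.bilinear_form_on_axioms sym(1) W2(2) W(4,2), simplified]
    by (simp add: algebra_simps)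
qed

end

section \<open>The fundamental lemma of the calculus of variations\<close>

text \<open>Smoothness follows from membership in any family closed under partial derivatives; this avoids
  computing higher derivatives.\<close>

lemma C_times_coinduct:
  assumes "f \<in> S"
    and "\<And>f. f \<in> S \<Longrightarrow> f differentiable_on UNIV"
    and "\<And>f b. f \<in> S \<Longrightarrow> b \<in> Basis \<Longrightarrow> (\<lambda>x. frechet_derivative f (at x) b) \<in> S"
  shows "C_times k f"
  using assms(1) by (induction k arbitrary: f) (auto simp: assms differentiable_imp_continuous_on)

lemma frechet_derivative_eq:
  assumes "\<And>x. (f has_derivative f' x) (at x)"
  shows "(\<lambda>x. frechet_derivative f (at x) b) = (\<lambda>x. f' x b)"
  using frechet_derivative_at[OF assms] by auto

lemma C_times_SucI:
  assumes "\<And>x. (f has_derivative f' x) (at x)" "\<And>b. b \<in> Basis \<Longrightarrow> C_times k (\<lambda>x. f' x b)"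
  shows "C_times (Suc k) f"
  using assms by (auto simp: frechet_derivative_eq[OF assms(1)] differentiable_on_def intro: differentiableI)

lemma C_times_SucD:
  assumes "C_times (Suc k) f"
  shows "(f has_derivative frechet_derivative f (at x)) (at x)"
  using assms by (simp add: differentiable_on_def flip: frechet_derivative_works)

lemma C_times_lower: "C_times (Suc k) f \<Longrightarrow> C_times k f"
  by (induction k arbitrary: f) (auto simp: differentiable_imp_continuous_on)

lemma C_times_const: "C_times k (\<lambda>x. c)"
proof (rule C_times_coinduct[where S = "range (\<lambda>c x. c)"])
  fix f :: "'a \<Rightarrow> real" and b :: 'a
  assume "f \<in> range (\<lambda>c x. c)"
  then obtain c where "f = (\<lambda>x. c)" by auto
  then show "(\<lambda>x. frechet_derivative f (at x) b) \<in> range (\<lambda>c x. c)" by auto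
qed auto

lemma C_times_add: "C_times k f \<Longrightarrow> C_times k g \<Longrightarrow> C_times k (\<lambda>x. f x + g x)"
proof (induction k arbitrary: f g)
  case (Suc k)
  show ?case
    by (rule C_times_SucI[OF has_derivative_add[OF C_times_SucD[OF Suc.prems(1)] C_times_SucD[OF Suc.prems(2)]]])
       (use Suc in auto)
qed (auto intro: continuous_intros)

lemma C_times_mult: "C_times k f \<Longrightarrow> C_times k g \<Longrightarrow> C_times k (\<lambda>x. f x * g x)"
proof (induction k arbitrary: f g)
  case (Suc k)
  show ?case
    by (rule C_times_SucI[OF has_derivative_mult[OF C_times_SucD[OF Suc.prems(1)] C_times_SucD[OF Suc.prems(2)]]])
       (use Suc C_times_lower[OF Suc.prems(1)] C_times_lower[OF Suc.prems(2)] in \<open>auto intro!: C_times_add\<close>)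
qed (auto intro: continuous_intros)

lemma C_times_prod: "(\<And>i. i \<in> I \<Longrightarrow> C_times k (f i)) \<Longrightarrow> C_times k (\<lambda>x. \<Prod>i\<in>I. f i x)"
  by (induction I rule: infinite_finite_induct) (auto intro: C_times_mult C_times_const)

text \<open>The derivatives of \<open>exp (- 1 / t)\<close>, extended by zero to \<open>t \<le> 0\<close>, are polynomials in \<open>1 / t\<close> times that
  function. Admitting all polynomials \<open>p\<close> gives a family closed under differentiation.\<close>

definition flat :: "real poly \<Rightarrow> real \<Rightarrow> real" where
  "flat p t = (if t \<le> 0 then 0 else poly p (1 / t) * exp (- (1 / t)))"

lemma poly_times_exp_neg_tendsto_0: "((\<lambda>x. poly p x * exp (- x)) \<longlongrightarrow> 0) at_top" for p :: "real poly"
proof -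
  have "((\<lambda>x. \<Sum>i\<le>degree p. coeff p i * (x ^ i / exp x)) \<longlongrightarrow> 0) at_top"
    by (intro tendsto_null_sum tendsto_mult_right_zero tendsto_power_div_exp_0)
  then show ?thesis by (simp add: poly_altdef sum_distrib_right exp_minus divide_inverse mult.assoc)
qed

text \<open>Away from \<open>0\<close> this is the product rule. At \<open>0\<close> the difference quotient is again of the form
  polynomial times exponential in \<open>1 / h\<close>, so it tends to \<open>0\<close>.\<close>

lemma has_real_derivative_flat:
  "(flat p has_real_derivative flat ([:0, 0, 1:] * (p - pderiv p)) t) (at t)"
proof -
  consider "t < 0" | "t = 0" | "t > 0" by linarith
  then show ?thesis
  proof cases
    case 1
    have "((\<lambda>_. 0) has_real_derivative 0) (at t)" by simp
    moreover have "\<forall>\<^sub>F s in nhds t. flat p s = 0"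
      using 1 by (auto simp: flat_def eventually_nhds intro!: exI[of _ "{..<0}"])
    ultimately show ?thesis using 1 by (subst DERIV_cong_ev) (auto simp: flat_def)
  next
    case 3
    have "((\<lambda>t. poly p (1 / t) * exp (- (1 / t))) has_real_derivative
        flat ([:0, 0, 1:] * (p - pderiv p)) t) (at t)"
      using 3 by (auto intro!: derivative_eq_intros simp: flat_def field_simps power2_eq_square)
    moreover have "\<forall>\<^sub>F s in nhds t. flat p s = poly p (1 / s) * exp (- (1 / s))"
      using 3 by (auto simp: flat_def eventually_nhds intro!: exI[of _ "{0<..}"])
    ultimately show ?thesis using 3 by (subst DERIV_cong_ev) auto
  next
    case 2
    have right: "((\<lambda>h. flat p h / h) \<longlongrightarrow> 0) (at_right 0)"
    proof -
      have "((\<lambda>h. poly (pCons 0 p) (inverse h) * exp (- inverse h)) \<longlongrightarrow> 0) (at_right 0)"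
        by (rule filterlim_compose[OF poly_times_exp_neg_tendsto_0 filterlim_inverse_at_top_right])
      moreover have "\<forall>\<^sub>F h in at_right 0. poly (pCons 0 p) (inverse h) * exp (- inverse h) = flat p h / h"
        by (auto simp: flat_def field_simps intro!: eventually_at_rightI[of 0 1])
      ultimately show ?thesis by (rule Lim_transform_eventually)
    qed
    have "\<forall>\<^sub>F h in at_left 0. 0 = flat p h / h"
      by (auto simp: flat_def intro!: eventually_at_leftI[of "-1"])
    then have "((\<lambda>h. flat p h / h) \<longlongrightarrow> 0) (at_left 0)"
      by (rule Lim_transform_eventually[OF tendsto_const])
    with right have "((\<lambda>h. flat p h / h) \<longlongrightarrow> 0) (at 0)"
      by (simp add: filterlim_split_at)
    then show ?thesis using 2 by (simp add: DERIV_def flat_def)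
  qed
qed

lemma C_times_flat: "C_times k (\<lambda>x. flat p (c * (x \<bullet> i) + e))"
proof (rule C_times_coinduct[where S = "range (\<lambda>p x. flat p (c * (x \<bullet> i) + e))"])
  have D: "((\<lambda>x. flat p (c * (x \<bullet> i) + e)) has_derivative
     (\<lambda>h. (c * (h \<bullet> i)) * flat ([:0, 0, 1:] * (p - pderiv p)) (c * (x \<bullet> i) + e))) (at x)" for p and x :: 'a
    by (rule DERIV_compose_FDERIV[OF has_real_derivative_flat]) (auto intro!: derivative_eq_intros)
  fix f :: "'a \<Rightarrow> real" assume "f \<in> range (\<lambda>p x. flat p (c * (x \<bullet> i) + e))"
  then obtain p where f: "f = (\<lambda>x. flat p (c * (x \<bullet> i) + e))" by auto
  show "f differentiable_on UNIV"
    unfolding f differentiable_on_def using D[of p] by (auto intro: differentiableI)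
  show "(\<lambda>x. frechet_derivative f (at x) b) \<in> range (\<lambda>p x. flat p (c * (x \<bullet> i) + e))" for b
    unfolding f frechet_derivative_eq[OF D]
    by (intro image_eqI[of _ _ "smult (c * (b \<bullet> i)) ([:0, 0, 1:] * (p - pderiv p))"])
       (auto simp: flat_def fun_eq_iff)
qed auto

lemma flat_one: "flat 1 t = (if t \<le> 0 then 0 else exp (- (1 / t)))"
  by (simp add: flat_def)

text \<open>Scaling the argument by \<open>n\<close> leaves the support unchanged and drives every factor
  \<open>exp (- 1 / (n * t))\<close> to \<open>1\<close> for \<open>t > 0\<close>, so that no mollification is needed to approximate an indicator.\<close>

definition box_bump :: "'a::euclidean_space \<Rightarrow> 'a \<Rightarrow> nat \<Rightarrow> 'a \<Rightarrow> real" where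
  "box_bump a b n x = (\<Prod>i\<in>Basis. flat 1 (real n * (x \<bullet> i - a \<bullet> i)) * flat 1 (real n * (b \<bullet> i - x \<bullet> i)))"

lemma box_bump_smooth: "C_times k (box_bump a b n)"
proof -
  have "C_times k (\<lambda>x. flat 1 (real n * (x \<bullet> i - a \<bullet> i)) * flat 1 (real n * (b \<bullet> i - x \<bullet> i)))" for i
    using C_times_mult[OF C_times_flat[of k 1 "real n" i "- real n * (a \<bullet> i)"]
        C_times_flat[of k 1 "- real n" i "real n * (b \<bullet> i)"]]
    by (simp add: algebra_simps)
  then show ?thesis unfolding box_bump_def[abs_def] by (intro C_times_prod)
qed

lemma box_bump_outside: "x \<notin> box a b \<Longrightarrow> box_bump a b n x = 0"
proof -
  assume "x \<notin> box a b"
  then obtain i where i: "i \<in> Basis" "x \<bullet> i - a \<bullet> i \<le> 0 \<or> b \<bullet> i - x \<bullet> i \<le> 0"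
    by (auto simp: mem_box not_less)
  then have "flat 1 (real n * (x \<bullet> i - a \<bullet> i)) * flat 1 (real n * (b \<bullet> i - x \<bullet> i)) = 0"
    by (auto simp: flat_one mult_le_0_iff)
  then show ?thesis using i(1) unfolding box_bump_def by (intro prod_zero) auto
qed

lemma box_bump_test_function:
  assumes "cbox a b \<subseteq> \<Omega>"
  shows "box_bump a b n \<in> test_functions \<Omega>"
proof -
  have "{x. box_bump a b n x \<noteq> 0} \<subseteq> cbox a b"
    using box_bump_outside box_subset_cbox by blast
  then have "closure {x. box_bump a b n x \<noteq> 0} \<subseteq> cbox a b" by (simp add: closure_minimal closed_cbox)
  moreover from this have "compact (closure {x. box_bump a b n x \<noteq> 0})"
    by (meson bounded_cbox bounded_subset closed_closure compact_eq_bounded_closed)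
  ultimately show ?thesis using assms box_bump_smooth unfolding test_functions_def by blast
qed

lemma box_bump_bounds: "0 \<le> box_bump a b n x" "box_bump a b n x \<le> 1"
  unfolding box_bump_def by (auto intro!: prod_nonneg prod_le_1 mult_le_one simp: flat_one)

lemma box_bump_tendsto: "(\<lambda>n. box_bump a b n x) \<longlonglongrightarrow> indicator (box a b) x"
proof (cases "x \<in> box a b")
  case True
  have flat: "(\<lambda>n. flat 1 (real n * t)) \<longlonglongrightarrow> 1" if "t > 0" for t
  proof -
    have "(\<lambda>n. exp (- (1 / t) * (1 / real n))) \<longlonglongrightarrow> exp (- (1 / t) * 0)"
      by (intro tendsto_intros lim_1_over_n)
    moreover have "\<forall>\<^sub>F n in sequentially. exp (- (1 / t) * (1 / real n)) = flat 1 (real n * t)"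
      using eventually_gt_at_top[of 0] by eventually_elim (use that in \<open>auto simp: flat_one mult_le_0_iff field_simps\<close>)
    ultimately show ?thesis by (simp add: Lim_transform_eventually)
  qed
  have "(\<lambda>n. box_bump a b n x) \<longlonglongrightarrow> (\<Prod>i::'a\<in>Basis. 1 * 1)"
    unfolding box_bump_def using True by (intro tendsto_prod tendsto_mult flat) (auto simp: mem_box)
  then show ?thesis using True by simp
qed (simp add: box_bump_outside)

lemma box_integral_zero:
  fixes \<Omega> :: "'a::euclidean_space set"
  assumes \<Omega>: "open \<Omega>" and g: "integrable (lebesgue_on \<Omega>) g"
    and orth: "\<And>\<phi>. \<phi> \<in> test_functions \<Omega> \<Longrightarrow> L2_inner \<Omega> g \<phi> = 0"
    and ab: "cbox a b \<subseteq> \<Omega>"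
  shows "(\<integral>x. g x * indicator (box a b) x \<partial>lebesgue_on \<Omega>) = 0"
proof -
  have gm: "g \<in> borel_measurable (lebesgue_on \<Omega>)" using g by simp
  have \<Omega>_sets: "\<Omega> \<in> sets lebesgue" using \<Omega> by (simp add: borel_open)
  have bump: "box_bump a b n \<in> borel_measurable (lebesgue_on \<Omega>)" for n
    using box_bump_smooth[of 0 a b n] \<Omega>_sets
    by (intro continuous_imp_measurable_on_sets_lebesgue) (auto intro: continuous_on_subset)
  have box: "(\<lambda>x. indicator (box a b) x :: real) \<in> borel_measurable (lebesgue_on \<Omega>)"
    by (intro borel_measurable_LIMSEQ_real[OF box_bump_tendsto bump])
  have "(\<lambda>n. \<integral>x. g x * box_bump a b n x \<partial>lebesgue_on \<Omega>) \<longlonglongrightarrow>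
      (\<integral>x. g x * indicator (box a b) x \<partial>lebesgue_on \<Omega>)"
  proof (rule integral_dominated_convergence[where w = "\<lambda>x. norm (g x)"])
    show "AE x in lebesgue_on \<Omega>. (\<lambda>n. g x * box_bump a b n x) \<longlonglongrightarrow> g x * indicator (box a b) x"
      by (intro AE_I2 tendsto_mult box_bump_tendsto tendsto_const)
    show "AE x in lebesgue_on \<Omega>. norm (g x * box_bump a b n x) \<le> norm (g x)" for n
      using box_bump_bounds[of a b n] by (intro AE_I2) (auto simp: abs_mult mult_left_le)
  qed (use gm bump box g in auto)
  moreover have "(\<integral>x. g x * box_bump a b n x \<partial>lebesgue_on \<Omega>) = 0" for n
    using orth[OF box_bump_test_function[OF ab]] by (simp add: L2_inner_def)
  ultimately show ?thesis by (simp add: LIMSEQ_const_iff)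
qed

text \<open>Boxes are stable under intersection and generate the Borel sets, so by Dynkin's argument all Borel
  set integrals vanish; Lebesgue sets differ from Borel sets by null sets.\<close>

lemma AE_zero_if_box_integrals_zero:
  fixes f :: "'a::euclidean_space \<Rightarrow> real"
  assumes f: "integrable lebesgue f"
    and total: "(\<integral>x. f x \<partial>lebesgue) = 0"
    and boxes: "\<And>a b. (\<integral>x\<in>box a b. f x \<partial>lebesgue) = 0"
  shows "AE x in lebesgue. f x = 0"
proof -
  have int: "set_integrable lebesgue A f" if "A \<in> sets lebesgue" for A
    unfolding set_integrable_def by (rule integrable_mult_indicator[OF that f])
  have borel: "(\<integral>x\<in>A. f x \<partial>lebesgue) = 0" if A: "A \<in> sets borel" for A
  proof -
    let ?G = "range (\<lambda>(a, b). box a b :: 'a set)"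
    have sets: "sets borel = sigma_sets UNIV ?G"
      by (subst borel_eq_box) (simp add: sets_measure_of)
    have "Int_stable ?G"
      by (auto simp: Int_stable_def box_Int_box)
    moreover have "?G \<subseteq> Pow UNIV" by auto
    moreover have "A \<in> sigma_sets UNIV ?G" using A sets by simp
    ultimately show ?thesis
    proof (induction rule: sigma_sets_induct_disjoint)
      case (basic A)
      then show ?case using boxes by auto
    next
      case empty
      then show ?case by (simp add: set_lebesgue_integral_def)
    next
      case (compl A)
      then have A: "A \<in> sets lebesgue" by (simp flip: sets)
      then have "(\<integral>x\<in>A \<union> (UNIV - A). f x \<partial>lebesgue) = (\<integral>x\<in>A. f x \<partial>lebesgue) + (\<integral>x\<in>UNIV - A. f x \<partial>lebesgue)"
        by (intro set_integral_Un int) auto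
      then show ?case using compl total by (simp add: set_lebesgue_integral_def)
    next
      case (union A)
      then have "A i \<in> sets borel" for i using sets by blast
      then have A: "A i \<in> sets lebesgue" for i by simp
      have "(LINT x:(\<Union>i. A i)|lebesgue. f x) = (\<Sum>i. (LINT x:(A i)|lebesgue. f x))"
        using union(1) A by (intro lebesgue_integral_countable_add int) (auto simp: disjoint_family_on_def)
      then show ?case using union(3) by simp
    qed
  qed
  have "AE x in lebesgue. f x = (\<lambda>_. 0) x"
  proof (rule density_unique_real)
    fix A :: "'a set" assume "A \<in> sets lebesgue"
    then obtain S N N' where A: "A = S \<union> N" "N \<subseteq> N'" "N' \<in> null_sets lborel" "S \<in> sets lborel"
      by (rule sets_completionE)
    have "AE x in lebesgue. x \<notin> N'"
      using A(3) by (intro AE_not_in) (auto simp: null_sets_completionI)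
    then have "(\<integral>x\<in>A. f x \<partial>lebesgue) = (\<integral>x\<in>S. f x \<partial>lebesgue)"
      using A(1,2,4) int[OF \<open>A \<in> sets lebesgue\<close>] int[of S]
      unfolding set_lebesgue_integral_def set_integrable_def
      by (intro integral_cong_AE borel_measurable_integrable) (auto simp: indicator_def)
    then show "(\<integral>x\<in>A. f x \<partial>lebesgue) = (\<integral>x\<in>A. 0 \<partial>lebesgue)"
      using borel A(4) by simp
  qed (use f in auto)
  then show ?thesis by simp
qed

text \<open>The integral of \<open>g\<close> vanishes over every box whose closure lies in \<open>\<Omega>\<close>. Cutting \<open>g\<close> off outside one such box
  reduces to integrals over all boxes of the whole space, because boxes intersect in boxes; countably many
  closed boxes cover \<open>\<Omega>\<close>.\<close>

lemma AE_zero_if_orthogonal_to_test_functions: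
  fixes \<Omega> :: "'a::euclidean_space set"
  assumes \<Omega>: "open \<Omega>" and g: "integrable (lebesgue_on \<Omega>) g"
    and orth: "\<And>\<phi>. \<phi> \<in> test_functions \<Omega> \<Longrightarrow> L2_inner \<Omega> g \<phi> = 0"
  shows "AE x in lebesgue_on \<Omega>. g x = 0"
proof -
  have \<Omega>_sets: "\<Omega> \<in> sets lebesgue" using \<Omega> by (simp add: borel_open)
  have on_box: "AE x in lebesgue. x \<in> cbox a b \<longrightarrow> g x = 0" if ab: "cbox a b \<subseteq> \<Omega>" for a b
  proof -
    define f where "f x = indicator \<Omega> x * (g x * indicator (box a b) x)" for x
    \<comment> \<open>Inside \<open>box a b\<close> the cut-off in \<open>f\<close> has no effect.\<close>
    have box_int: "(\<integral>x. indicator (box c d) x * f x \<partial>lebesgue) = 0" if "cbox c d \<subseteq> cbox a b" for c d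
    proof -
      have "cbox c d \<subseteq> \<Omega>" "box c d \<subseteq> box a b"
        using that ab by (auto simp flip: interior_cbox intro: interior_mono[THEN subsetD])
      have "(\<integral>x. indicator (box c d) x * f x \<partial>lebesgue)
          = (\<integral>x. g x * indicator (box c d) x \<partial>lebesgue_on \<Omega>)"
        using \<Omega>_sets \<open>box c d \<subseteq> box a b\<close>
        by (subst integral_restrict_space) (auto simp: f_def indicator_def intro!: Bochner_Integration.integral_cong)
      also have "\<dots> = 0" by (rule box_integral_zero[OF \<Omega> g orth \<open>cbox c d \<subseteq> \<Omega>\<close>])
      finally show ?thesis .
    qed
    have "AE x in lebesgue. f x = 0"
    proof (rule AE_zero_if_box_integrals_zero)
      have "integrable lebesgue (\<lambda>x. indicator \<Omega> x * g x)"
        using g \<Omega>_sets by (simp add: integrable_restrict_space)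
      then have "integrable lebesgue (\<lambda>x. indicator (box a b) x *\<^sub>R (indicator \<Omega> x * g x))"
        by (intro integrable_mult_indicator) auto
      then show "integrable lebesgue f" by (simp add: f_def[abs_def] mult_ac)
      show "(\<integral>x. f x \<partial>lebesgue) = 0"
        using box_int[of a b] by (simp add: f_def mult.left_commute Int_ac flip: indicator_inter_arith)
      fix c d :: 'a
      let ?c = "\<Sum>i\<in>Basis. max (a\<bullet>i) (c\<bullet>i) *\<^sub>R i" and ?d = "\<Sum>i\<in>Basis. min (b\<bullet>i) (d\<bullet>i) *\<^sub>R i"
      have "(\<integral>x\<in>box c d. f x \<partial>lebesgue) = (\<integral>x. indicator (box a b \<inter> box c d) x * f x \<partial>lebesgue)"
        unfolding set_lebesgue_integral_def
        by (intro Bochner_Integration.integral_cong) (auto simp: f_def indicator_def)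
      also have "\<dots> = 0" unfolding box_Int_box
        by (rule box_int) (auto simp: mem_box)
      finally show "(\<integral>x\<in>box c d. f x \<partial>lebesgue) = 0" .
    qed
    \<comment> \<open>The covering uses closed boxes, while bumps only see open ones.\<close>
    moreover have "AE x in lebesgue. x \<notin> cbox a b - box a b"
      using negligible_frontier_interval[of a b] by (intro AE_not_in) (simp add: negligible_iff_null_sets)
    ultimately show ?thesis
    proof eventually_elim
      case (elim x)
      then show ?case using ab by (auto simp: f_def indicator_def split: if_splits)
    qed
  qed
  obtain \<D> where \<D>: "countable \<D>" "\<D> \<subseteq> Pow \<Omega>" "\<And>X. X \<in> \<D> \<Longrightarrow> \<exists>a b. X = cbox a b" "\<Union>\<D> = \<Omega>"
    using open_countable_Union_open_cbox[OF \<Omega>] by metis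
  have "AE x in lebesgue. \<forall>X\<in>\<D>. x \<in> X \<longrightarrow> g x = 0"
  proof (subst AE_ball_countable[OF \<D>(1)], intro ballI)
    fix X assume "X \<in> \<D>"
    then obtain a b where "X = cbox a b" "cbox a b \<subseteq> \<Omega>" using \<D> by blast
    then show "AE x in lebesgue. x \<in> X \<longrightarrow> g x = 0" using on_box by blast
  qed
  then have "AE x in lebesgue. x \<in> \<Omega> \<longrightarrow> g x = 0"
    by eventually_elim (use \<D>(4) in blast)
  then show ?thesis using \<Omega>_sets by (simp add: AE_restrict_space_iff)
qed

section \<open>Square-integrable functions on bounded open sets\<close>

lemma L2_mult_integrable:
  assumes "f \<in> L2_space \<Omega>" "g \<in> L2_space \<Omega>"
  shows "integrable (lebesgue_on \<Omega>) (\<lambda>x. f x * g x)"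
proof (rule Bochner_Integration.integrable_bound)
  show "integrable (lebesgue_on \<Omega>) (\<lambda>x. (f x)\<^sup>2 + (g x)\<^sup>2)"
    using assms by (auto simp: L2_space_def)
  show "(\<lambda>x. f x * g x) \<in> borel_measurable (lebesgue_on \<Omega>)"
    using assms by (auto simp: L2_space_def)
  have "\<bar>s * t\<bar> \<le> s\<^sup>2 + t\<^sup>2" for s t :: real
  proof -
    have "2 * (\<bar>s\<bar> * \<bar>t\<bar>) \<le> s\<^sup>2 + t\<^sup>2" "0 \<le> \<bar>s\<bar> * \<bar>t\<bar>"
      using sum_squares_bound[of "\<bar>s\<bar>" "\<bar>t\<bar>"] by (simp_all add: mult.assoc)
    then show ?thesis unfolding abs_mult by linarith
  qed
  then show "AE x in lebesgue_on \<Omega>. norm (f x * g x) \<le> norm ((f x)\<^sup>2 + (g x)\<^sup>2)"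
    by (intro AE_I2) (simp add: abs_mult)
qed

lemma subspace_L2: "subspace (L2_space \<Omega>)"
proof (rule subspaceI)
  fix f g assume fg: "f \<in> L2_space \<Omega>" "g \<in> L2_space \<Omega>"
  then have "integrable (lebesgue_on \<Omega>) (\<lambda>x. (f x)\<^sup>2 + (g x)\<^sup>2 + 2 * (f x * g x))"
    using L2_mult_integrable[OF fg] by (auto simp: L2_space_def)
  with fg show "f + g \<in> L2_space \<Omega>"
    by (auto simp: L2_space_def power2_sum plus_fun_def mult.assoc)
next
  show "c *\<^sub>R f \<in> L2_space \<Omega>" if "f \<in> L2_space \<Omega>" for c f
    using that by (auto simp: L2_space_def power_mult_distrib scaleR_fun_def)
qed (auto simp: L2_space_def zero_fun_def)

lemma bilinear_L2_inner: "bilinear_form_on (L2_space \<Omega>) (L2_inner \<Omega>)"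
  by standard
    (simp_all add: subspace_L2 L2_inner_def algebra_simps L2_mult_integrable Bochner_Integration.integral_add)

lemma L2_inner_commute: "L2_inner \<Omega> f g = L2_inner \<Omega> g f"
  by (simp add: L2_inner_def mult.commute)

lemma continuous_L2:
  fixes \<Omega> :: "'a::euclidean_space set"
  assumes "open \<Omega>" "bounded \<Omega>" "continuous_on (closure \<Omega>) f"
  shows "f \<in> L2_space \<Omega>"
proof -
  have \<Omega>: "\<Omega> \<in> lmeasurable" "\<Omega> \<in> sets lebesgue"
    using assms by (auto simp: bounded_set_imp_lmeasurable borel_open)
  interpret finite_measure "lebesgue_on \<Omega>" by (rule finite_measure_lebesgue_on[OF \<Omega>(1)])
  have "compact (f ` closure \<Omega>)"
    using assms by (intro compact_continuous_image) (auto simp: compact_closure)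
  then obtain C where C: "\<And>x. x \<in> closure \<Omega> \<Longrightarrow> \<bar>f x\<bar> \<le> C"
    by (force dest!: compact_imp_bounded simp: bounded_iff)
  have f: "f \<in> borel_measurable (lebesgue_on \<Omega>)"
    using assms(3) \<Omega> by (intro continuous_imp_measurable_on_sets_lebesgue)
      (auto intro: continuous_on_subset[OF _ closure_subset])
  moreover have "integrable (lebesgue_on \<Omega>) (\<lambda>x. (f x)\<^sup>2)"
  proof (rule integrable_const_bound)
    show "AE x in lebesgue_on \<Omega>. norm ((f x)\<^sup>2) \<le> C\<^sup>2"
      using C closure_subset[of \<Omega>]
      by (intro AE_I2) (auto simp: abs_le_square_iff[symmetric] intro: order_trans[OF _ abs_ge_self])
  qed (use f in auto)
  ultimately show ?thesis by (simp add: L2_space_def)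
qed

lemma test_function_continuous:
  assumes "\<phi> \<in> test_functions \<Omega>"
  shows "continuous_on S \<phi>" "b \<in> Basis \<Longrightarrow> continuous_on S (\<lambda>x. frechet_derivative \<phi> (at x) b)"
proof -
  have "C_times 0 \<phi>" "C_times (Suc 0) \<phi>" using assms by (auto simp: test_functions_def)
  then show "continuous_on S \<phi>" "b \<in> Basis \<Longrightarrow> continuous_on S (\<lambda>x. frechet_derivative \<phi> (at x) b)"
    by (auto intro: continuous_on_subset)
qed

section \<open>Uniqueness and linearity of weak gradients\<close>

text \<open>Two weak gradients have components that differ by a function orthogonal to all test functions.\<close>

lemma has_weak_gradient_AE_unique:
  assumes \<Omega>: "open \<Omega>" "bounded \<Omega>" and g: "has_weak_gradient \<Omega> v g" "has_weak_gradient \<Omega> v g'"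
  shows "AE x in lebesgue_on \<Omega>. g x = g' x"
proof -
  interpret bilinear_form_on "L2_space \<Omega>" "L2_inner \<Omega>" by (rule bilinear_L2_inner)
  have comp: "AE x in lebesgue_on \<Omega>. g x \<bullet> b - g' x \<bullet> b = 0" if b: "b \<in> Basis" for b
  proof -
    let ?d = "(\<lambda>x. g x \<bullet> b) - (\<lambda>x. g' x \<bullet> b)"
    have L2: "(\<lambda>x. g x \<bullet> b) \<in> L2_space \<Omega>" "(\<lambda>x. g' x \<bullet> b) \<in> L2_space \<Omega>"
      using g b by (auto simp: has_weak_gradient_def)
    have "AE x in lebesgue_on \<Omega>. ?d x = 0"
    proof (rule AE_zero_if_orthogonal_to_test_functions[OF \<Omega>(1)])
      have "integrable (lebesgue_on \<Omega>) (\<lambda>x. ?d x * 1)"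
        using L2 \<Omega> by (intro L2_mult_integrable closed(4)) (auto intro: continuous_L2)
      then show "integrable (lebesgue_on \<Omega>) ?d" by (simp add: fun_diff_def)
      fix \<phi> assume \<phi>: "\<phi> \<in> test_functions \<Omega>"
      then have "\<phi> \<in> L2_space \<Omega>" using \<Omega> test_function_continuous(1) continuous_L2 by blast
      then have "L2_inner \<Omega> ?d \<phi> = L2_inner \<Omega> (\<lambda>x. g x \<bullet> b) \<phi> - L2_inner \<Omega> (\<lambda>x. g' x \<bullet> b) \<phi>"
        using L2 by (intro diff_left)
      also have "\<dots> = 0" using g b \<phi> by (simp add: has_weak_gradient_def)
      finally show "L2_inner \<Omega> ?d \<phi> = 0" .
    qed
    then show ?thesis by simp
  qed
  have "AE x in lebesgue_on \<Omega>. \<forall>b\<in>Basis. g x \<bullet> b - g' x \<bullet> b = 0"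
    using comp by (subst AE_ball_countable) (auto simp: countable_finite)
  then show ?thesis by eventually_elim (auto intro: euclidean_eqI)
qed

lemma has_weak_gradient_linear:
  assumes \<Omega>: "open \<Omega>" "bounded \<Omega>"
    and v: "v \<in> L2_space \<Omega>" "has_weak_gradient \<Omega> v g"
    and w: "w \<in> L2_space \<Omega>" "has_weak_gradient \<Omega> w g'"
  shows "has_weak_gradient \<Omega> (c *\<^sub>R v + w) (\<lambda>x. c *\<^sub>R g x + g' x)"
  unfolding has_weak_gradient_def
proof (intro ballI conjI)
  interpret bilinear_form_on "L2_space \<Omega>" "L2_inner \<Omega>" by (rule bilinear_L2_inner)
  fix b :: 'a assume b: "b \<in> Basis"
  have L2: "(\<lambda>x. g x \<bullet> b) \<in> L2_space \<Omega>" "(\<lambda>x. g' x \<bullet> b) \<in> L2_space \<Omega>"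
    using v w b by (auto simp: has_weak_gradient_def)
  have eq: "(\<lambda>x. (c *\<^sub>R g x + g' x) \<bullet> b) = c *\<^sub>R (\<lambda>x. g x \<bullet> b) + (\<lambda>x. g' x \<bullet> b)"
    by (auto simp: inner_simps)
  show "(\<lambda>x. (c *\<^sub>R g x + g' x) \<bullet> b) \<in> L2_space \<Omega>" unfolding eq using L2 by simp
  fix \<phi> assume \<phi>: "\<phi> \<in> test_functions \<Omega>"
  then have "\<phi> \<in> L2_space \<Omega>" "(\<lambda>x. frechet_derivative \<phi> (at x) b) \<in> L2_space \<Omega>"
    using \<Omega> test_function_continuous[OF \<phi>] b continuous_L2 by blast+
  then show "L2_inner \<Omega> (c *\<^sub>R v + w) (\<lambda>x. frechet_derivative \<phi> (at x) b) =
      - L2_inner \<Omega> (\<lambda>x. (c *\<^sub>R g x + g' x) \<bullet> b) \<phi>"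
    unfolding eq using v w L2 b \<phi> by (simp add: add_left scale_left has_weak_gradient_def)
qed

lemma weak_gradient: "v \<in> H1_space \<Omega> \<Longrightarrow> has_weak_gradient \<Omega> v (weak_gradient \<Omega> v)"
  unfolding weak_gradient_def by (rule someI_ex[of "has_weak_gradient \<Omega> v"]) (simp add: H1_space_def)

lemma subspace_H1:
  assumes \<Omega>: "open \<Omega>" "bounded \<Omega>"
  shows "subspace (H1_space \<Omega>)"
proof -
  have 0: "0 \<in> H1_space \<Omega>"
    using subspace_0[OF subspace_L2]
    by (auto simp: H1_space_def has_weak_gradient_def L2_inner_def zero_fun_def intro!: exI[of _ "\<lambda>_. 0"])
  moreover have lin: "c *\<^sub>R v + w \<in> H1_space \<Omega>" if "v \<in> H1_space \<Omega>" "w \<in> H1_space \<Omega>" for c v w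
    using that has_weak_gradient_linear[OF \<Omega>, of v _ w _ c] subspace_L2 unfolding H1_space_def
    by (blast intro: subspace_add subspace_scale)
  ultimately show ?thesis
    using lin[of _ _ 1] lin[of _ 0] by (auto intro: subspaceI)
qed

text \<open>The chosen gradient need not depend linearly on the function, but the linear combination of the chosen
  gradients is a weak gradient as well, and uniqueness identifies the two.\<close>

lemma AE_weak_gradient_linear:
  assumes \<Omega>: "open \<Omega>" "bounded \<Omega>" and v: "v \<in> H1_space \<Omega>" "w \<in> H1_space \<Omega>"
  shows "AE x in lebesgue_on \<Omega>.
    weak_gradient \<Omega> (c *\<^sub>R v + w) x = c *\<^sub>R weak_gradient \<Omega> v x + weak_gradient \<Omega> w x"
proof (rule has_weak_gradient_AE_unique[OF \<Omega>])
  show "has_weak_gradient \<Omega> (c *\<^sub>R v + w) (weak_gradient \<Omega> (c *\<^sub>R v + w))"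
    using v subspace_H1[OF \<Omega>] by (intro weak_gradient subspace_add subspace_scale)
  show "has_weak_gradient \<Omega> (c *\<^sub>R v + w) (\<lambda>x. c *\<^sub>R weak_gradient \<Omega> v x + weak_gradient \<Omega> w x)"
    using has_weak_gradient_linear[OF \<Omega> _ weak_gradient[OF v(1)] _ weak_gradient[OF v(2)]] v
    by (simp add: H1_space_def)
qed

lemma weak_gradient_inner_integrable:
  assumes "v \<in> H1_space \<Omega>" "w \<in> H1_space \<Omega>"
  shows "integrable (lebesgue_on \<Omega>) (\<lambda>x. weak_gradient \<Omega> v x \<bullet> weak_gradient \<Omega> w x)"
proof -
  have comp: "(\<lambda>x. weak_gradient \<Omega> v x \<bullet> b) \<in> L2_space \<Omega>" if "v \<in> H1_space \<Omega>" "b \<in> Basis" for v b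
    using weak_gradient[OF that(1)] that(2) unfolding has_weak_gradient_def by blast
  have eq: "(\<lambda>x. weak_gradient \<Omega> v x \<bullet> weak_gradient \<Omega> w x) =
      (\<lambda>x. \<Sum>b\<in>Basis. (weak_gradient \<Omega> v x \<bullet> b) * (weak_gradient \<Omega> w x \<bullet> b))"
    by (rule ext) (rule euclidean_inner)
  show ?thesis
    unfolding eq by (intro Bochner_Integration.integrable_sum L2_mult_integrable comp assms)
qed

lemma diffusion_form_commute: "diffusion_form \<Omega> a v w = diffusion_form \<Omega> a w v"
  by (simp add: diffusion_form_def inner_commute)

lemma diffusion_form_linear:
  assumes \<Omega>: "open \<Omega>" "bounded \<Omega>" and H1: "v \<in> H1_space \<Omega>" "w \<in> H1_space \<Omega>" "z \<in> H1_space \<Omega>"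
  shows "diffusion_form \<Omega> (\<lambda>_. e) (c *\<^sub>R v + w) z =
    c * diffusion_form \<Omega> (\<lambda>_. e) v z + diffusion_form \<Omega> (\<lambda>_. e) w z"
proof -
  let ?G = "weak_gradient \<Omega>" and ?M = "lebesgue_on \<Omega>"
  have "c *\<^sub>R v + w \<in> H1_space \<Omega>"
    using H1 subspace_H1[OF \<Omega>] by (intro subspace_add subspace_scale)
  note int = weak_gradient_inner_integrable[OF this H1(3)]
    weak_gradient_inner_integrable[OF H1(1,3)] weak_gradient_inner_integrable[OF H1(2,3)]
  have "(\<integral>x. ?G (c *\<^sub>R v + w) x \<bullet> ?G z x \<partial>?M) =
      (\<integral>x. c * (?G v x \<bullet> ?G z x) + ?G w x \<bullet> ?G z x \<partial>?M)"
  proof (rule integral_cong_AE)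
    show "AE x in ?M. ?G (c *\<^sub>R v + w) x \<bullet> ?G z x = c * (?G v x \<bullet> ?G z x) + ?G w x \<bullet> ?G z x"
      using AE_weak_gradient_linear[OF \<Omega> H1(1,2), of c] by eventually_elim (simp add: inner_simps)
  qed (use int in auto)
  also have "\<dots> = c * (\<integral>x. ?G v x \<bullet> ?G z x \<partial>?M) + (\<integral>x. ?G w x \<bullet> ?G z x \<partial>?M)"
    using int by simp
  finally show ?thesis by (simp add: diffusion_form_def algebra_simps)
qed

lemma bilinear_diffusion_form:
  assumes \<Omega>: "open \<Omega>" "bounded \<Omega>"
  shows "bilinear_form_on (H1_space \<Omega>) (diffusion_form \<Omega> (\<lambda>_. e))"
proof -
  note H1 = subspace_H1[OF \<Omega>]
  let ?d = "diffusion_form \<Omega> (\<lambda>_. e)"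
  have add: "?d (x + y) z = ?d x z + ?d y z"
    if "x \<in> H1_space \<Omega>" "y \<in> H1_space \<Omega>" "z \<in> H1_space \<Omega>" for x y z
    using diffusion_form_linear[OF \<Omega> that, of e 1] by simp
  have zero: "?d 0 y = 0" if "y \<in> H1_space \<Omega>" for y
    using add[of 0 0 y] that subspace_0[OF H1] by simp
  have scale: "?d (c *\<^sub>R x) y = c * ?d x y" if "x \<in> H1_space \<Omega>" "y \<in> H1_space \<Omega>" for x y c
    using diffusion_form_linear[OF \<Omega> that(1) subspace_0[OF H1] that(2), of e c] zero that by simp
  show ?thesis
  proof
    fix x y z c assume "x \<in> H1_space \<Omega>" "y \<in> H1_space \<Omega>"
    then show "?d (c *\<^sub>R x) y = c * ?d x y" "?d x (c *\<^sub>R y) = c * ?d x y"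
      using scale[of x y c] scale[of y x c] by (simp_all add: diffusion_form_commute[of \<Omega> "\<lambda>_. e" x])
    assume "z \<in> H1_space \<Omega>"
    with \<open>x \<in> _\<close> \<open>y \<in> _\<close> show "?d (x + y) z = ?d x z + ?d y z" "?d x (y + z) = ?d x y + ?d x z"
      using add[of x y z] add[of y z x] by (simp_all add: diffusion_form_commute[of \<Omega> "\<lambda>_. e" x])
  qed (rule H1)
qed

lemma diffusion_form_nonneg: "e \<ge> 0 \<Longrightarrow> diffusion_form \<Omega> (\<lambda>_. e) v v \<ge> 0"
  by (simp add: diffusion_form_def)

section \<open>The finite element space\<close>

definition monomial :: "('a::euclidean_space \<Rightarrow> nat) \<Rightarrow> 'a \<Rightarrow> real" where
  "monomial \<alpha> x = (\<Prod>b\<in>Basis. (x \<bullet> b) ^ \<alpha> b)"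

lemma polys_iff: "p \<in> polys k \<longleftrightarrow> (\<exists>c. \<forall>x. p x = (\<Sum>\<alpha>\<in>multi_indices k. c \<alpha> * monomial \<alpha> x))"
  by (auto simp: polys_def monomial_def fun_eq_iff)

lemma finite_multi_indices: "finite (multi_indices k :: ('a::euclidean_space \<Rightarrow> nat) set)"
proof (rule finite_subset)
  show "multi_indices k \<subseteq> {\<alpha>::'a \<Rightarrow> nat. \<forall>b. (b \<in> Basis \<longrightarrow> \<alpha> b \<in> {..k}) \<and> (b \<notin> Basis \<longrightarrow> \<alpha> b = 0)}"
  proof
    fix \<alpha> :: "'a \<Rightarrow> nat" assume \<alpha>: "\<alpha> \<in> multi_indices k"
    have "\<alpha> b \<le> k" if "b \<in> Basis" for b
      using member_le_sum[of b Basis \<alpha>] that \<alpha> by (simp add: multi_indices_def)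
    then show "\<alpha> \<in> {\<alpha>. \<forall>b. (b \<in> Basis \<longrightarrow> \<alpha> b \<in> {..k}) \<and> (b \<notin> Basis \<longrightarrow> \<alpha> b = 0)}"
      using \<alpha> by (simp add: multi_indices_def)
  qed
  show "finite {\<alpha>::'a \<Rightarrow> nat. \<forall>b. (b \<in> Basis \<longrightarrow> \<alpha> b \<in> {..k}) \<and> (b \<notin> Basis \<longrightarrow> \<alpha> b = 0)}"
    by (rule finite_set_of_finite_funs) auto
qed

lemma subspace_polys: "subspace (polys k)"
proof (rule subspaceI)
  show "0 \<in> polys k" unfolding polys_iff by (intro exI[of _ "\<lambda>_. 0"]) simp
next
  fix p q :: "'a \<Rightarrow> real" assume "p \<in> polys k" "q \<in> polys k"
  then obtain c d where "\<And>x. p x = (\<Sum>\<alpha>\<in>multi_indices k. c \<alpha> * monomial \<alpha> x)"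
    "\<And>x. q x = (\<Sum>\<alpha>\<in>multi_indices k. d \<alpha> * monomial \<alpha> x)" unfolding polys_iff by metis
  then show "p + q \<in> polys k" unfolding polys_iff
    by (intro exI[of _ "\<lambda>\<alpha>. c \<alpha> + d \<alpha>"]) (simp add: distrib_right sum.distrib)
next
  fix c and p :: "'a \<Rightarrow> real" assume "p \<in> polys k"
  then obtain d where "\<And>x. p x = (\<Sum>\<alpha>\<in>multi_indices k. d \<alpha> * monomial \<alpha> x)" unfolding polys_iff by metis
  then show "c *\<^sub>R p \<in> polys k" unfolding polys_iff
    by (intro exI[of _ "\<lambda>\<alpha>. c * d \<alpha>"]) (simp add: sum_distrib_left mult.assoc)
qed

lemma fem_continuous_L2_H1:
  assumes "v \<in> fem_space \<Omega> \<T> k"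
  shows "continuous_on (closure \<Omega>) v" "v \<in> H1_space \<Omega>" "v \<in> L2_space \<Omega>"
  using assms by (auto simp: fem_space_def H1_space_def)

lemma subspace_fem:
  assumes \<Omega>: "open \<Omega>" "bounded \<Omega>"
  shows "subspace (fem_space \<Omega> \<T> k)"
proof (rule subspaceI)
  note H1 = subspace_H1[OF \<Omega>] and P = subspace_polys[of k]
  show "0 \<in> fem_space \<Omega> \<T> k"
    using subspace_0[OF H1] subspace_0[OF P] by (auto simp: fem_space_def zero_fun_def intro!: bexI[of _ "\<lambda>_. 0"])
next
  fix v w assume v: "v \<in> fem_space \<Omega> \<T> k" and w: "w \<in> fem_space \<Omega> \<T> k"
  have "\<exists>p\<in>polys k. \<forall>x\<in>T. (v + w) x = p x" if T: "T \<in> \<T>" for T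
  proof -
    obtain p q where "p \<in> polys k" "q \<in> polys k" "\<forall>x\<in>T. v x = p x" "\<forall>x\<in>T. w x = q x"
      using v w T unfolding fem_space_def by blast
    then show ?thesis using subspace_add[OF subspace_polys, of p k q] by (intro bexI[of _ "p + q"]) auto
  qed
  then show "v + w \<in> fem_space \<Omega> \<T> k"
    using v w subspace_add[OF subspace_H1[OF \<Omega>]]
    by (auto simp: fem_space_def plus_fun_def intro: continuous_on_add)
next
  fix c v assume v: "v \<in> fem_space \<Omega> \<T> k"
  have "\<exists>p\<in>polys k. \<forall>x\<in>T. (c *\<^sub>R v) x = p x" if T: "T \<in> \<T>" for T
  proof -
    obtain p where "p \<in> polys k" "\<forall>x\<in>T. v x = p x" using v T unfolding fem_space_def by blast
    then show ?thesis using subspace_scale[OF subspace_polys, of p k c] by (intro bexI[of _ "c *\<^sub>R p"]) auto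
  qed
  then show "c *\<^sub>R v \<in> fem_space \<Omega> \<T> k"
    using v subspace_scale[OF subspace_H1[OF \<Omega>]]
    by (auto simp: fem_space_def scaleR_fun_def intro: continuous_on_mult_left)
qed

text \<open>Elements overlap on their faces, so monomials cut off to the elements would be counted several times
  there. Choosing one element \<open>\<tau> x\<close> for every point \<open>x\<close> makes the pieces disjoint; the resulting
  generators are discontinuous, which is harmless since only their number matters.\<close>

lemma fem_finite_span:
  assumes "triangulates \<T> \<Omega>"
  obtains E where "finite E" "fem_space \<Omega> \<T> k \<subseteq> span E"
proof -
  define \<tau> where "\<tau> x = (SOME T. T \<in> \<T> \<and> x \<in> T)" for x
  define e where "e T \<alpha> x = (if x \<in> closure \<Omega> \<and> \<tau> x = T then monomial \<alpha> x else 0)" for T \<alpha> x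
  have \<T>: "finite \<T>" "\<Union>\<T> = closure \<Omega>"
    using assms by (auto simp: triangulates_def triangulation_def)
  let ?E = "(\<lambda>(T, \<alpha>). e T \<alpha>) ` (\<T> \<times> multi_indices k)"
  have "v \<in> span ?E" if v: "v \<in> fem_space \<Omega> \<T> k" for v
  proof -
    have "\<forall>T\<in>\<T>. \<exists>c. \<forall>x\<in>T. v x = (\<Sum>\<alpha>\<in>multi_indices k. c \<alpha> * monomial \<alpha> x)"
      using v unfolding fem_space_def polys_iff mem_Collect_eq Bex_def by metis
    then obtain c where c: "\<And>T x. T \<in> \<T> \<Longrightarrow> x \<in> T \<Longrightarrow> v x = (\<Sum>\<alpha>\<in>multi_indices k. c T \<alpha> * monomial \<alpha> x)"
      by metis
    have "v x = (\<Sum>T\<in>\<T>. \<Sum>\<alpha>\<in>multi_indices k. c T \<alpha> * e T \<alpha> x)" for x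
    proof (cases "x \<in> closure \<Omega>")
      case True
      then have \<tau>: "\<tau> x \<in> \<T>" "x \<in> \<tau> x"
        using \<T>(2) someI_ex[of "\<lambda>T. T \<in> \<T> \<and> x \<in> T"] by (auto simp: \<tau>_def)
      have "(\<Sum>T\<in>\<T>. \<Sum>\<alpha>\<in>multi_indices k. c T \<alpha> * e T \<alpha> x)
          = (\<Sum>T\<in>\<T>. if \<tau> x = T then \<Sum>\<alpha>\<in>multi_indices k. c T \<alpha> * monomial \<alpha> x else 0)"
        using True by (intro sum.cong) (auto simp: e_def)
      then show ?thesis using c[OF \<tau>] \<tau>(1) \<T>(1) by simp
    qed (use v in \<open>auto simp: fem_space_def e_def\<close>)
    then have "v = (\<Sum>T\<in>\<T>. \<Sum>\<alpha>\<in>multi_indices k. c T \<alpha> *\<^sub>R e T \<alpha>)"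
      by (simp add: fun_eq_iff sum_fun_apply)
    also have "\<dots> \<in> span ?E"
      by (intro span_sum span_scale span_base) auto
    finally show ?thesis .
  qed
  then show ?thesis using that[of ?E] \<T>(1) finite_multi_indices by blast
qed

text \<open>If the norm is zero, then \<open>v\<close> vanishes almost everywhere on \<open>\<Omega>\<close>. The set where it does not vanish is
  open and negligible, hence empty; continuity carries this to the closure, and outside \<open>v\<close> is zero by
  the convention of \<open>fem_space\<close>.\<close>

lemma fem_L2_inner_pos:
  assumes \<Omega>: "open \<Omega>" "bounded \<Omega>" and v: "v \<in> fem_space \<Omega> \<T> k" "v \<noteq> 0"
  shows "L2_inner \<Omega> v v > 0"
proof (rule ccontr)
  assume "\<not> L2_inner \<Omega> v v > 0"
  moreover have "L2_inner \<Omega> v v \<ge> 0" by (simp add: L2_inner_def)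
  ultimately have 0: "(\<integral>x. v x * v x \<partial>lebesgue_on \<Omega>) = 0" unfolding L2_inner_def by linarith
  have "integrable (lebesgue_on \<Omega>) (\<lambda>x. v x * v x)"
    using v by (intro L2_mult_integrable fem_continuous_L2_H1(3))
  then have "AE x in lebesgue_on \<Omega>. v x * v x = 0"
    using 0 by (simp add: integral_nonneg_eq_0_iff_AE)
  then have "AE x in lebesgue. x \<in> \<Omega> \<longrightarrow> v x = 0"
    using \<Omega> by (simp add: AE_restrict_space_iff borel_open)
  moreover have cont: "continuous_on \<Omega> v"
    using fem_continuous_L2_H1(1)[OF v(1)] closure_subset continuous_on_subset by blast
  then have op: "open {x \<in> \<Omega>. v x \<noteq> 0}"
    using continuous_open_preimage[OF cont \<Omega>(1), of "- {0}"] by (simp add: vimage_def Int_def open_Compl)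
  then have "{x \<in> \<Omega>. v x \<noteq> 0} \<in> sets lebesgue" by (simp add: borel_open)
  ultimately have "negligible {x \<in> \<Omega>. v x \<noteq> 0}"
    by (simp add: negligible_iff_null_sets AE_iff_null_sets)
  then have "{x \<in> \<Omega>. v x \<noteq> 0} = {}" using op open_not_negligible by blast
  then have "v x = 0" if "x \<in> closure \<Omega>" for x
    using continuous_constant_on_closure[OF fem_continuous_L2_H1(1)[OF v(1)], of 0 x] that by blast
  moreover have "v x = 0" if "x \<notin> closure \<Omega>" for x using v that by (simp add: fem_space_def)
  ultimately have "v = 0" by (auto simp: fun_eq_iff)
  then show False using v by simp
qed

lemma fem_bilinear:
  assumes \<Omega>: "open \<Omega>" "bounded \<Omega>"
  shows "bilinear_form_on (fem_space \<Omega> \<T> k) (L2_inner \<Omega>)"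
    "bilinear_form_on (fem_space \<Omega> \<T> k) (diffusion_form \<Omega> (\<lambda>_. e))"
  using bilinear_form_on_subspace[OF bilinear_L2_inner subspace_fem[OF \<Omega>]]
    bilinear_form_on_subspace[OF bilinear_diffusion_form[OF \<Omega>] subspace_fem[OF \<Omega>]]
    fem_continuous_L2_H1 by blast+

lemma L2_proj_fem:
  assumes \<Omega>: "open \<Omega>" "bounded \<Omega>" and tri: "triangulates \<T> \<Omega>" and w: "w \<in> L2_space \<Omega>"
  shows "L2_proj \<Omega> (fem_space \<Omega> \<T> k) w \<in> fem_space \<Omega> \<T> k"
proof -
  interpret bilinear_form_on "L2_space \<Omega>" "L2_inner \<Omega>" by (rule bilinear_L2_inner)
  obtain E where E: "finite E" "fem_space \<Omega> \<T> k \<subseteq> span E" by (rule fem_finite_span[OF tri])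
  have "\<exists>!v. v \<in> fem_space \<Omega> \<T> k \<and> (\<forall>\<phi>\<in>fem_space \<Omega> \<T> k. L2_inner \<Omega> v \<phi> = L2_inner \<Omega> w \<phi>)"
  proof (rule ex1_representer[OF E fem_bilinear(1)[OF \<Omega>]])
    show "linear_form_on (fem_space \<Omega> \<T> k) (L2_inner \<Omega> w)"
      using w fem_continuous_L2_H1(3)[where \<Omega> = \<Omega> and \<T> = \<T> and k = k]
      by (simp add: linear_form_on_def add_right scale_right)
  qed (use fem_L2_inner_pos[OF \<Omega>] in force)
  from theI'[OF this] show ?thesis by (simp add: L2_proj_def)
qed

section \<open>The BDF2-IEQ finite element step\<close>

lemma continuous_ieq_H:
  assumes "open J" "F differentiable_on J" "continuous_on J (deriv F)"
    and "\<And>y. y \<in> Y \<Longrightarrow> y \<in> J \<and> F y + B > 0"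
  shows "continuous_on Y (ieq_H F B)"
proof -
  have "continuous_on Y F" "continuous_on Y (deriv F)" "\<And>y. y \<in> Y \<Longrightarrow> F y + B > 0"
    using assms differentiable_imp_continuous_on[OF assms(2)] by (auto intro: continuous_on_subset)
  then show ?thesis
    unfolding ieq_H_def[abs_def] by (intro continuous_intros) (auto simp: less_imp_neq[symmetric])
qed

text \<open>For \<open>U\<close> in the finite element space \<open>H * U\<close> is continuous on the compact closure, hence bounded and
  square-integrable; this makes the third form well defined and bilinear.\<close>

lemma ieq_forms_fem:
  assumes \<Omega>: "open \<Omega>" "bounded \<Omega>" and e: "e \<ge> 0" and H: "continuous_on (closure \<Omega>) H"
  shows "ieq_forms (fem_space \<Omega> \<T> k) (L2_inner \<Omega>) (diffusion_form \<Omega> (\<lambda>_. e))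
    (\<lambda>U. L2_inner \<Omega> (\<lambda>x. H x * U x))"
proof -
  let ?V = "fem_space \<Omega> \<T> k"
  interpret L: bilinear_form_on "L2_space \<Omega>" "L2_inner \<Omega>" by (rule bilinear_L2_inner)
  have HU: "(\<lambda>x. H x * U x) \<in> L2_space \<Omega>" if "U \<in> ?V" for U
    using fem_continuous_L2_H1(1)[OF that] H by (intro continuous_L2 \<Omega> continuous_on_mult)
  have eq: "(\<lambda>x. H x * (x' + y') x) = (\<lambda>x. H x * x' x) + (\<lambda>x. H x * y' x)"
    "(\<lambda>x. H x * (c *\<^sub>R x') x) = c *\<^sub>R (\<lambda>x. H x * x' x)" for x' y' c
    by (auto simp: algebra_simps)
  have "bilinear_form_on ?V (\<lambda>U. L2_inner \<Omega> (\<lambda>x. H x * U x))"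
    by standard (simp_all add: subspace_fem[OF \<Omega>] L.expand HU eq
        fem_continuous_L2_H1(3)[where \<Omega> = \<Omega> and \<T> = \<T> and k = k] del: plus_fun_apply fun_apply)
  moreover have "ieq_forms_axioms ?V (L2_inner \<Omega>) (diffusion_form \<Omega> (\<lambda>_. e))
      (\<lambda>U. L2_inner \<Omega> (\<lambda>x. H x * U x))"
    using fem_L2_inner_pos[OF \<Omega>] e
    by unfold_locales
      (auto simp: diffusion_form_nonneg L2_inner_commute diffusion_form_commute[of \<Omega> "\<lambda>_. e"] L2_inner_def mult_ac)
  ultimately show ?thesis
    using fem_bilinear[OF \<Omega>] by (intro ieq_forms.intro)
qed

theorem lemmaB2:
  fixes \<Omega> :: "'a::euclidean_space set"
    and \<T> :: "'a set set"
    and k :: nat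
    and F :: "real \<Rightarrow> real"
    and J :: "real set"
    and B \<epsilon> \<sigma> \<Delta>t :: real
    and u_init :: "'a \<Rightarrow> real"
    and u U :: "int \<Rightarrow> 'a \<Rightarrow> real"
    and n :: int
  defines "V \<equiv> fem_space \<Omega> \<T> k"
  assumes dim: "DIM('a) = 2 \<or> DIM('a) = 3"
    and domain: "open \<Omega>" "connected \<Omega>" "bounded \<Omega>" "\<Omega> \<noteq> {}"
    and mesh: "triangulates \<T> \<Omega>" "\<sigma> > 0" "quasi_uniform \<sigma> \<T>"
    and params: "\<epsilon> > 0" "B \<ge> 0" "\<Delta>t > 0"
    and F_C1: "open J" "F differentiable_on J" "continuous_on J (deriv F)"
    and u_init_L2: "u_init \<in> L2_space \<Omega>"
    and U_init_L2: "(\<lambda>x. sqrt (F (u_init x) + B)) \<in> L2_space \<Omega>"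
    and u_init_pos: "AE x in lebesgue_on \<Omega>. u_init x \<in> J \<and> F (u_init x) + B > 0"
    and init_u: "u (-1) = L2_proj \<Omega> V u_init" "u 0 = L2_proj \<Omega> V u_init"
    and init_U: "U (-1) = L2_proj \<Omega> V (\<lambda>x. sqrt (F (u_init x) + B))"
                "U 0 = L2_proj \<Omega> V (\<lambda>x. sqrt (F (u_init x) + B))"
    and n: "n \<ge> 0"
    and previous_steps: "\<And>m. 0 \<le> m \<Longrightarrow> m < n \<Longrightarrow>
        bdf2_ieq_step \<Omega> V F B \<epsilon> \<Delta>t (u (m - 1)) (U (m - 1)) (u m) (U m) (u (m + 1)) (U (m + 1))"
    and extrap_pos: "\<And>m x. 0 \<le> m \<Longrightarrow> m \<le> n \<Longrightarrow> x \<in> closure \<Omega> \<Longrightarrow>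
        extrap (u m) (u (m - 1)) x \<in> J \<and> F (extrap (u m) (u (m - 1)) x) + B > 0"
  shows "(\<exists>!w. bdf2_ieq_step \<Omega> V F B \<epsilon> \<Delta>t
                 (u (n - 1)) (U (n - 1)) (u n) (U n) (fst w) (snd w)) \<and>
         (\<forall>v W. bdf2_ieq_step \<Omega> V F B \<epsilon> \<Delta>t (u (n - 1)) (U (n - 1)) (u n) (U n) v W \<longrightarrow>
            bdf2_energy \<Omega> \<epsilon> B (u n) (U n) v W =
              bdf2_energy \<Omega> \<epsilon> B (u (n - 1)) (U (n - 1)) (u n) (U n)
              - 1 / (4 * \<Delta>t) * (L2_norm \<Omega> (bdf2 v (u n) (u (n - 1))))\<^sup>2
              - 1 / 4 * diffusion_form \<Omega> (\<lambda>_. \<epsilon>\<^sup>2)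
                  (\<lambda>x. v x - extrap (u n) (u (n - 1)) x) (\<lambda>x. v x - extrap (u n) (u (n - 1)) x)
              - 1 / 2 * (L2_norm \<Omega> (\<lambda>x. W x - extrap (U n) (U (n - 1)) x))\<^sup>2)"
proof -
  note \<Omega> = domain(1,3)
  have "u m \<in> V \<and> U m \<in> V" if m: "-1 \<le> m" "m \<le> n" for m
  proof (cases "m \<le> 0")
    case True
    then have "m = -1 \<or> m = 0" using m by linarith
    then show ?thesis
      using init_u init_U L2_proj_fem[OF \<Omega> mesh(1)] u_init_L2 U_init_L2 by (auto simp: V_def)
  next
    case False
    then show ?thesis
      using previous_steps[of "m - 1"] m by (auto simp: bdf2_ieq_step_def)
  qed
  then have inV: "u (n - 1) \<in> V" "U (n - 1) \<in> V" "u n \<in> V" "U n \<in> V" using n by auto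
  define H where "H x = ieq_H F B (extrap (u n) (u (n - 1)) x)" for x
  have "continuous_on (closure \<Omega>) (u n)" "continuous_on (closure \<Omega>) (u (n - 1))"
    using inV fem_continuous_L2_H1(1)[of _ \<Omega> \<T> k] by (simp_all add: V_def)
  then have "continuous_on (closure \<Omega>) (extrap (u n) (u (n - 1)))"
    unfolding extrap_def by (intro continuous_on_diff continuous_on_mult_left)
  moreover have "continuous_on (extrap (u n) (u (n - 1)) ` closure \<Omega>) (ieq_H F B)"
    using extrap_pos[OF n order_refl] by (intro continuous_ieq_H[OF F_C1]) auto
  ultimately have "continuous_on (closure \<Omega>) H"
    using continuous_on_compose[of "closure \<Omega>" "extrap (u n) (u (n - 1))" "ieq_H F B"]
    by (simp add: H_def[abs_def] o_def)
  then interpret ieq_forms V "L2_inner \<Omega>" "diffusion_form \<Omega> (\<lambda>_. \<epsilon>\<^sup>2)" "\<lambda>U. L2_inner \<Omega> (\<lambda>x. H x * U x)"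
    unfolding V_def by (intro ieq_forms_fem \<Omega>) simp_all
  have extrap: "extrap x y = 2 *\<^sub>R x - y" for x y :: "'a \<Rightarrow> real"
    by (auto simp: extrap_def)
  have bdf2: "bdf2 x y z = bdf x y z" for x y z
    by (auto simp: bdf2_def bdf_def)
  have step_iff: "bdf2_ieq_step \<Omega> V F B \<epsilon> \<Delta>t (u (n - 1)) (U (n - 1)) (u n) (U n) v W \<longleftrightarrow>
      step \<Delta>t (u (n - 1)) (U (n - 1)) (u n) (U n) v W" for v W
  proof -
    have "L2_inner \<Omega> (\<lambda>x. w x / (2 * \<Delta>t)) \<phi> = L2_inner \<Omega> w \<phi> / (2 * \<Delta>t)"
      "L2_inner \<Omega> (\<lambda>x. 1 / 2 * H x * (w x / (2 * \<Delta>t))) \<phi> = L2_inner \<Omega> (\<lambda>x. H x * w x) \<phi> / (4 * \<Delta>t)"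
      for w \<phi> by (simp_all add: L2_inner_def)
    then show ?thesis unfolding bdf2_ieq_step_def step_def H_def[symmetric] bdf2 by simp
  qed
  have norm: "(L2_norm \<Omega> f)\<^sup>2 = L2_inner \<Omega> f f" for f
    by (simp add: L2_norm_def L2_inner_def)
  have energy: "ieq_energy \<Omega> \<epsilon> B x X = 1 / 2 * diffusion_form \<Omega> (\<lambda>_. \<epsilon>\<^sup>2) x x + L2_inner \<Omega> X X
      - B * measure lebesgue \<Omega>" for x X
    by (simp add: ieq_energy_def L2_inner_def power2_eq_square)
  obtain E where E: "finite E" "V \<subseteq> span E" unfolding V_def by (rule fem_finite_span[OF mesh(1)])
  have diff: "(\<lambda>x. f x - g x) = f - g" for f g :: "'a \<Rightarrow> real" by auto
  show ?thesis
    unfolding step_iff bdf2_energy_def energy norm diff extrap bdf2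
    using ex1_step[OF E params(3) inV] step_energy[OF _ params(3) inV, of _ _ "B * measure lebesgue \<Omega>"]
    by blast
qed

end
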